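(* Let $G$ be a triangle-free graph of maximum degree at most three. If there exists a good $3$-coloring of $G$, then $G$ has a $(172:60)$-coloring.
   Context: An $(a:b)$-coloring of $G$ assigns to each vertex a $b$-element subset of $\{1,\dots,a\}$ so that adjacent vertices receive disjoint sets. Let $L_0$ be the graph obtained from a path on four vertices by adding two new vertices, each adjacent to both ends of the path. A tuple $(v_1,v_2,v_3,v_4,u_1,u_2)$ of six distinct vertices of $G$ forms a copy of $L_0$ if these six vertices induce a graph isomorphic to $L_0$ in which $u_1v_1v_2v_3v_4u_1$ and $u_2v_1v_2v_3v_4u_2$ are the two 5-cycles. Given a proper $3$-coloring $f$ of $G$, such a copy is $f$-rainbow if $f(u_1)=f(u_2)=\pi(1)$, $f(v_1)=f(v_3)=\pi(2)$, $f(v_2)=f(v_4)=\pi(3)$ for some permutation $\pi$ of $\{1,2,3\}$. A leaf is a vertex of degree one; a support vertex is a vertex adjacent to a leaf. A graph $H$ is good if it is bipartite, has maximum degree at most three, and: (G1) no vertex of degree three is adjacent to three vertices of degree three; (G2) for every pair of adjacent vertices $x,y$ of degree three, either at least one of $x,y$ is adjacent to a leaf, or each of $x,y$ is adjacent to a support vertex of degree two; (G3) if $x,y,z$ are vertices of degree three such that $xyz$ is a path, each of $x$ and $z$ is adjacent to a leaf, and the neighbor $y'$ of $y$ other than $x,z$ has degree two, then the neighbor of $y'$ other than $y$ is a leaf; (G4) if $x,y,z$ are vertices of degree three such that $xyz$ is a path and $N(z)=\{z_1,z_2,y\}$ with $\deg(z_1)\ge 2$ and $\deg(z_2)\ge 2$,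 then $z_1$ or $z_2$ is a support vertex of degree two. A $3$-coloring $f$ of $G$ is good if it is proper, $G$ contains no $f$-rainbow copy of $L_0$, and for every two of the three color classes, the subgraph of $G$ induced by their union is a good graph. *)

theory Defs
  imports "Graph_Theory.Graph_Theory" "HOL-Combinatorics.Permutations"
begin

text \<open>
  A finite simple graph is a \<^term>\<open>graph\<close>, i.e. a finite loop-free symmetric digraph without
  parallel arcs. An edge is a pair of opposite arcs, so the degree of a vertex is its
  \<^term>\<open>out_degree\<close>, and adjacency is \<^term>\<open>dominates\<close>.
\<close>

definition neighborhood :: "('a,'b) pre_digraph \<Rightarrow> 'a \<Rightarrow> 'a set" where
  "neighborhood G v = {w. v \<rightarrow>\<^bsub>G\<^esub> w}"

definition triangle_free :: "('a,'b) pre_digraph \<Rightarrow> bool" where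
  "triangle_free G \<longleftrightarrow> \<not> (\<exists>x y z. x \<rightarrow>\<^bsub>G\<^esub> y \<and> y \<rightarrow>\<^bsub>G\<^esub> z \<and> z \<rightarrow>\<^bsub>G\<^esub> x)"

definition max_degree_le :: "('a,'b) pre_digraph \<Rightarrow> nat \<Rightarrow> bool" where
  "max_degree_le G k \<longleftrightarrow> (\<forall>v \<in> verts G. out_degree G v \<le> k)"

definition bipartite :: "('a,'b) pre_digraph \<Rightarrow> bool" where
  "bipartite G \<longleftrightarrow> (\<exists>X Y. verts G = X \<union> Y \<and> X \<inter> Y = {} \<and>
     (\<forall>u v. u \<rightarrow>\<^bsub>G\<^esub> v \<longrightarrow> (u \<in> X \<and> v \<in> Y) \<or> (u \<in> Y \<and> v \<in> X)))"

definition leaf :: "('a,'b) pre_digraph \<Rightarrow> 'a \<Rightarrow> bool" where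
  "leaf G v \<longleftrightarrow> v \<in> verts G \<and> out_degree G v = 1"

definition support_vertex :: "('a,'b) pre_digraph \<Rightarrow> 'a \<Rightarrow> bool" where
  "support_vertex G v \<longleftrightarrow> (\<exists>w. v \<rightarrow>\<^bsub>G\<^esub> w \<and> leaf G w)"

definition ab_coloring :: "('a,'b) pre_digraph \<Rightarrow> nat \<Rightarrow> nat \<Rightarrow> ('a \<Rightarrow> nat set) \<Rightarrow> bool" where
  "ab_coloring G a b \<phi> \<longleftrightarrow>
     (\<forall>v \<in> verts G. \<phi> v \<subseteq> {1..a} \<and> card (\<phi> v) = b) \<and>
     (\<forall>u v. u \<rightarrow>\<^bsub>G\<^esub> v \<longrightarrow> \<phi> u \<inter> \<phi> v = {})"

definition proper_3_coloring :: "('a,'b) pre_digraph \<Rightarrow> ('a \<Rightarrow> nat) \<Rightarrow> bool" where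
  "proper_3_coloring G f \<longleftrightarrow>
     (\<forall>v \<in> verts G. f v \<in> {1,2,3}) \<and> (\<forall>u v. u \<rightarrow>\<^bsub>G\<^esub> v \<longrightarrow> f u \<noteq> f v)"

text \<open>The path is \<open>1 2 3 4\<close>; the two added vertices are \<open>5\<close> and \<open>6\<close>.\<close>

definition L0 :: "(nat, nat \<times> nat) pre_digraph" where
  "L0 = (let E = {(1,2), (2,3), (3,4)} \<union> {(5,1), (5,4), (6,1), (6,4)}
         in with_proj \<lparr> pverts = {1..6}, parcs = E \<union> E\<inverse> \<rparr>)"

definition L0_copy :: "('a,'b) pre_digraph \<Rightarrow> 'a \<Rightarrow> 'a \<Rightarrow> 'a \<Rightarrow> 'a \<Rightarrow> 'a \<Rightarrow> 'a \<Rightarrow> bool" where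
  "L0_copy G v1 v2 v3 v4 u1 u2 \<longleftrightarrow>
     distinct [v1,v2,v3,v4,u1,u2] \<and> {v1,v2,v3,v4,u1,u2} \<subseteq> verts G \<and>
     (let H = G \<restriction> {v1,v2,v3,v4,u1,u2} in
        digraph_iso H L0 \<and>
        vwalk [u1,v1,v2,v3,v4,u1] H \<and> vwalk [u2,v1,v2,v3,v4,u2] H)"

definition rainbow_L0_copy ::
  "('a,'b) pre_digraph \<Rightarrow> ('a \<Rightarrow> nat) \<Rightarrow> 'a \<Rightarrow> 'a \<Rightarrow> 'a \<Rightarrow> 'a \<Rightarrow> 'a \<Rightarrow> 'a \<Rightarrow> bool" where
  "rainbow_L0_copy G f v1 v2 v3 v4 u1 u2 \<longleftrightarrow>
     L0_copy G v1 v2 v3 v4 u1 u2 \<and>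
     (\<exists>\<pi>. \<pi> permutes {1,2,3} \<and>
        f u1 = \<pi> 1 \<and> f u2 = \<pi> 1 \<and>
        f v1 = \<pi> 2 \<and> f v3 = \<pi> 2 \<and>
        f v2 = \<pi> 3 \<and> f v4 = \<pi> 3)"

definition G1 :: "('a,'b) pre_digraph \<Rightarrow> bool" where
  "G1 H \<longleftrightarrow> \<not> (\<exists>x a b c. out_degree H x = 3 \<and> distinct [a,b,c] \<and>
     (\<forall>y \<in> {a,b,c}. x \<rightarrow>\<^bsub>H\<^esub> y \<and> out_degree H y = 3))"

definition G2 :: "('a,'b) pre_digraph \<Rightarrow> bool" where
  "G2 H \<longleftrightarrow> (\<forall>x y. x \<rightarrow>\<^bsub>H\<^esub> y \<and> out_degree H x = 3 \<and> out_degree H y = 3 \<longrightarrow>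
     (\<exists>v \<in> {x,y}. \<exists>w. v \<rightarrow>\<^bsub>H\<^esub> w \<and> leaf H w) \<or>
     (\<forall>v \<in> {x,y}. \<exists>w. v \<rightarrow>\<^bsub>H\<^esub> w \<and> support_vertex H w \<and> out_degree H w = 2))"

definition G3 :: "('a,'b) pre_digraph \<Rightarrow> bool" where
  "G3 H \<longleftrightarrow> (\<forall>x y z y' w.
     vpath [x,y,z] H \<and> out_degree H x = 3 \<and> out_degree H y = 3 \<and> out_degree H z = 3 \<and>
     (\<exists>l. x \<rightarrow>\<^bsub>H\<^esub> l \<and> leaf H l) \<and> (\<exists>l. z \<rightarrow>\<^bsub>H\<^esub> l \<and> leaf H l) \<and>
     y' \<in> neighborhood H y - {x,z} \<and> out_degree H y' = 2 \<and>
     w \<in> neighborhood H y' - {y} \<longrightarrow> leaf H w)"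

definition G4 :: "('a,'b) pre_digraph \<Rightarrow> bool" where
  "G4 H \<longleftrightarrow> (\<forall>x y z z1 z2.
     vpath [x,y,z] H \<and> out_degree H x = 3 \<and> out_degree H y = 3 \<and> out_degree H z = 3 \<and>
     neighborhood H z = {z1,z2,y} \<and> out_degree H z1 \<ge> 2 \<and> out_degree H z2 \<ge> 2 \<longrightarrow>
     (support_vertex H z1 \<and> out_degree H z1 = 2) \<or>
     (support_vertex H z2 \<and> out_degree H z2 = 2))"

definition good_graph :: "('a,'b) pre_digraph \<Rightarrow> bool" where
  "good_graph H \<longleftrightarrow> bipartite H \<and> max_degree_le H 3 \<and> G1 H \<and> G2 H \<and> G3 H \<and> G4 H"

definition good_3_coloring :: "('a,'b) pre_digraph \<Rightarrow> ('a \<Rightarrow> nat) \<Rightarrow> bool" where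
  "good_3_coloring G f \<longleftrightarrow>
     proper_3_coloring G f \<and>
     \<not> (\<exists>v1 v2 v3 v4 u1 u2. rainbow_L0_copy G f v1 v2 v3 v4 u1 u2) \<and>
     (\<forall>i \<in> {1,2,3}. \<forall>j \<in> {1,2,3}. i \<noteq> j \<longrightarrow>
        good_graph (G \<restriction> {v \<in> verts G. f v = i \<or> f v = j}))"

end

theory Submission
  imports Defs
begin

text \<open>
  A colour class of a proper 3-colouring is an independent set with bipartite complement. Among
  all such sets \<open>X\<close> choose one that maximises first its size, then the number of isolated
  vertices of the complement, then the number of vertices in two-vertex components of the
  complement. Maximality forces the complement to be a union of paths and even cycles, and it
  severely restricts how a vertex of \<open>X\<close> meets leaves and interior vertices of these paths.

  We look for sets of 15 out of 43 colours; multiplying every colour by four gives the theorem.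
  The 43 colours are split into 13 for \<open>X\<close> and 15 for each of the two sides of the complement.
  A vertex of \<open>X\<close> is short of two colours, which it borrows from the palettes of the two sides.
  Isolated vertices of the complement can choose after everything else, since each of their
  three neighbours borrows at most five colours. A leaf of the complement gives up up to three
  colours of its own palette and takes in exchange the colours which its only neighbour in the
  complement gives up; an interior vertex next to a leaf gives up up to three colours and takes in
  exchange colours of \<open>X\<close>, which its only neighbour in \<open>X\<close> then has to borrow as well.
  All remaining choices are greedy: every set of forbidden colours is small enough.
\<close>

text \<open>A vertex of \<open>X\<close> whose non-isolated neighbours all lie on one side can
  borrow from the other palette, dodging only the few colours that its leaves take there. The
  obstacle is a vertex meeting both sides: what it borrows must be given up on one side and must not
  be taken on the other, and a leaf takes exactly what its neighbour gives up, so obligations travel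
  along the paths of the complement. This dependence is broken by fixing an order of choice:
  \<open>cols\<close> for those vertices of \<open>X\<close> without support neighbour whose demands
  bind several leaves, \<open>D\<close> for the leaves, \<open>\<Delta>\<close> for the supports. A
  later set contains its share of the earlier ones as a base, and only its new part has to dodge
  conflicts. Optimality bounds the number of conflicts and excludes leaves with incompatible duties.
  The palette size 15 is used up exactly: a leaf may face 6 + 6 forbidden colours and needs 3, a
  support with two leaves faces 12 and needs 3, and an isolated vertex may lose 3 * 5 of 30. The 5
  arises as 2 + 3: two missing colours, and three more when a support takes them from the colours of
  \<open>X\<close>.\<close>

lemma greedy_sets:
  fixes b F :: "'i \<Rightarrow> nat set" and n :: "'i \<Rightarrow> nat"
  assumes fin: "finite S" "\<And>x. x \<in> S \<Longrightarrow> finite (F x)"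
    and base: "\<And>x. x \<in> S \<Longrightarrow> b x \<subseteq> {..<q} \<and> card (b x) \<le> n x"
    and few: "\<And>x D. x \<in> S \<Longrightarrow> (\<forall>y\<in>S. b y \<subseteq> D y \<and> D y \<subseteq> {..<q} \<and> card (D y) \<le> n y)
      \<Longrightarrow> card (F x \<union> (\<Union>y\<in>{y\<in>S. R x y}. D y - b y)) + n x \<le> q"
    and R: "\<And>x y. R x y \<Longrightarrow> R y x" "\<And>x. \<not> R x x"
  shows "\<exists>D. \<forall>x\<in>S. b x \<subseteq> D x \<and> D x \<subseteq> {..<q} \<and> card (D x) = n x \<and> (D x - b x) \<inter> F x = {} \<and>
    (\<forall>y\<in>S. R x y \<longrightarrow> (D x - b x) \<inter> (D y - b y) = {})"
proof -
  \<comment> \<open>Unprocessed elements still hold their base set, so their new part is empty.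
    Since \<open>few\<close> is assumed for every intermediate assignment, the order of processing
    is irrelevant.\<close>
  have "\<exists>D. (\<forall>y\<in>S. b y \<subseteq> D y \<and> D y \<subseteq> {..<q} \<and> card (D y) \<le> n y) \<and>
      (\<forall>x\<in>S'. card (D x) = n x \<and> (D x - b x) \<inter> F x = {} \<and>
        (\<forall>y\<in>S'. R x y \<longrightarrow> (D x - b x) \<inter> (D y - b y) = {}))"
    if "finite S'" "S' \<subseteq> S" for S'
    using that
  proof (induction S' rule: finite_induct)
    case empty
    then show ?case using base by (intro exI[of _ b]) auto
  next
    case (insert x S')
    then obtain D where D: "\<forall>y\<in>S. b y \<subseteq> D y \<and> D y \<subseteq> {..<q} \<and> card (D y) \<le> n y"
      and D': "\<forall>x\<in>S'. card (D x) = n x \<and> (D x - b x) \<inter> F x = {} \<and>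
        (\<forall>y\<in>S'. R x y \<longrightarrow> (D x - b x) \<inter> (D y - b y) = {})" by auto
    have xS: "x \<in> S" using insert by auto
    define Z where "Z = F x \<union> (\<Union>y\<in>{y\<in>S. R x y}. D y - b y)"
    have finD: "finite (D y)" if "y \<in> S" for y
      using D that finite_subset[of "D y" "{..<q}"] by auto
    have finZ: "finite Z" unfolding Z_def using fin xS finD by auto
    have finb: "finite (b x)" using base[OF xS] finite_subset by blast
    have "card Z + n x \<le> q" using few[OF xS D] Z_def by simp
    moreover have "q - card (b x \<union> Z) \<le> card ({..<q} - (b x \<union> Z))"
      using diff_card_le_card_Diff[of "b x \<union> Z" "{..<q}"] finb finZ by simp
    moreover have "card (b x \<union> Z) \<le> card (b x) + card Z" by (rule card_Un_le)
    ultimately have "n x - card (b x) \<le> card ({..<q} - (b x \<union> Z))"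
      using base[OF xS] by linarith
    then obtain P where P: "P \<subseteq> {..<q} - (b x \<union> Z)" "card P = n x - card (b x)"
      by (rule obtain_subset_with_card_n)
    have finP: "finite P" using P(1) finite_subset by blast
    have cP: "card (b x \<union> P) = n x"
      using P base[OF xS] finb finP by (subst card_Un_disjoint) auto
    have dP: "b x \<union> P - b x = P" using P(1) by auto
    define D2 where "D2 = D(x := b x \<union> P)"
    have *: "\<forall>y\<in>S. b y \<subseteq> D2 y \<and> D2 y \<subseteq> {..<q} \<and> card (D2 y) \<le> n y"
      using D base[OF xS] P(1) cP unfolding D2_def by auto
    have Rx: "P \<inter> (D y - b y) = {}" if "y \<in> S" "R x y" for y
      using that P(1) unfolding Z_def by auto
    have yx: "y \<noteq> x" if "y \<in> S'" for y using that insert by auto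
    have "\<forall>z\<in>insert x S'. card (D2 z) = n z \<and> (D2 z - b z) \<inter> F z = {} \<and>
        (\<forall>y\<in>insert x S'. R z y \<longrightarrow> (D2 z - b z) \<inter> (D2 y - b y) = {})"
    proof (intro ballI conjI impI)
      fix z assume z: "z \<in> insert x S'"
      show "card (D2 z) = n z" using z D' cP yx by (auto simp: D2_def)
      show "(D2 z - b z) \<inter> F z = {}" using z D' P(1) yx by (auto simp: D2_def Z_def)
      fix y assume y: "y \<in> insert x S'" and r: "R z y"
      have "z \<noteq> y" using r R(2) by auto
      then consider "z = x" "y \<in> S'" | "y = x" "z \<in> S'" | "z \<in> S'" "y \<in> S'" "z \<noteq> x" "y \<noteq> x"
        using z y by blast
      then show "(D2 z - b z) \<inter> (D2 y - b y) = {}"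
      proof cases
        case 1
        then show ?thesis using Rx[of y] r insert.prems yx[of y] dP by (auto simp: D2_def)
      next
        case 2
        then show ?thesis using Rx[of z] R(1)[OF r] insert.prems yx[of z] dP by (auto simp: D2_def)
      next
        case 3
        then show ?thesis using D' r by (auto simp: D2_def)
      qed
    qed
    with * show ?case by (intro exI[of _ D2] conjI)
  qed
  from this[OF fin(1) subset_refl] obtain D
    where "\<forall>y\<in>S. b y \<subseteq> D y \<and> D y \<subseteq> {..<q} \<and> card (D y) \<le> n y"
      "\<forall>x\<in>S. card (D x) = n x \<and> (D x - b x) \<inter> F x = {} \<and>
        (\<forall>y\<in>S. R x y \<longrightarrow> (D x - b x) \<inter> (D y - b y) = {})" by (elim exE conjE)
  then show ?thesis by (intro exI[of _ D]) auto
qed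

lemma finite_ex_max_nat:
  assumes "finite S" "S \<noteq> {}"
  shows "\<exists>x\<in>S. \<forall>y\<in>S. g y \<le> (g x :: nat)"
proof -
  have "Max (g ` S) \<in> g ` S" using assms by (intro Max_in) auto
  then obtain x where "x \<in> S" "Max (g ` S) = g x" by (rule imageE) auto
  moreover have "g y \<le> Max (g ` S)" if "y \<in> S" for y using that assms(1) by simp
  ultimately show ?thesis by (intro bexI[of _ x]) auto
qed

section \<open>Extremal independent sets\<close>

locale subcubic_triangle_free =
  fixes V :: "'a set" and E :: "'a \<Rightarrow> 'a \<Rightarrow> bool"
  assumes fin_V: "finite V"
    and E_V: "E x y \<Longrightarrow> x \<in> V"
    and E_sym: "E x y \<Longrightarrow> E y x"
    and no_tri: "E x y \<Longrightarrow> E y z \<Longrightarrow> E z x \<Longrightarrow> False"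
    and deg3: "card {y. E x y} \<le> 3"
begin

lemma E_V2: "E x y \<Longrightarrow> y \<in> V" using E_V E_sym by blast

lemma E_irrefl: "\<not> E x x" using no_tri by blast

lemma fin_N: "finite {y. E x y}"
  using fin_V E_V2 by (auto intro: finite_subset[of _ V])

definition inn :: "'a set \<Rightarrow> 'a \<Rightarrow> 'a set" where
  "inn X x = {y. E x y \<and> y \<in> X}"

definition out :: "'a set \<Rightarrow> 'a \<Rightarrow> 'a set" where
  "out X x = {y. E x y \<and> y \<notin> X}"

definition admissible :: "'a set \<Rightarrow> bool" where
  "admissible X \<longleftrightarrow> X \<subseteq> V \<and> (\<forall>x\<in>X. \<forall>y\<in>X. \<not> E x y) \<and>
     (\<exists>f :: 'a \<Rightarrow> bool. \<forall>x y. E x y \<longrightarrow> x \<notin> X \<longrightarrow> y \<notin> X \<longrightarrow> f x \<noteq> f y)"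

definition isos :: "'a set \<Rightarrow> 'a set" where
  "isos X = {x \<in> V - X. out X x = {}}"

definition pairs :: "'a set \<Rightarrow> 'a set" where
  "pairs X = {x \<in> V - X. \<exists>y. out X x = {y} \<and> out X y = {x}}"

definition optimal :: "'a set \<Rightarrow> bool" where
  "optimal X \<longleftrightarrow> admissible X \<and> (\<forall>Y. admissible Y \<longrightarrow> card Y \<le> card X \<and>
     (card Y = card X \<longrightarrow> card (isos Y) \<le> card (isos X) \<and>
       (card (isos Y) = card (isos X) \<longrightarrow> card (pairs Y) \<le> card (pairs X))))"

lemma optimal_exists:
  assumes "admissible X0"
  shows "\<exists>X. optimal X"
proof -
  define S where "S = {X. admissible X}"
  have fS: "finite S" unfolding S_def admissible_def
    by (rule finite_subset[of _ "Pow V"]) (auto simp: fin_V)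
  obtain X1 where X1: "X1 \<in> S" "\<forall>Y\<in>S. card Y \<le> card X1"
    using finite_ex_max_nat[OF fS, of card] assms S_def by auto
  define S1 where "S1 = {X\<in>S. card X = card X1}"
  obtain X2 where X2: "X2 \<in> S1" "\<forall>Y\<in>S1. card (isos Y) \<le> card (isos X2)"
    using finite_ex_max_nat[of S1 "\<lambda>X. card (isos X)"] fS X1 S1_def by auto
  define S2 where "S2 = {X\<in>S1. card (isos X) = card (isos X2)}"
  obtain X3 where X3: "X3 \<in> S2" "\<forall>Y\<in>S2. card (pairs Y) \<le> card (pairs X3)"
    using finite_ex_max_nat[of S2 "\<lambda>X. card (pairs X)"] fS X2 S1_def S2_def by auto
  have "optimal X3"
    using X1 X2 X3 unfolding optimal_def S_def S1_def S2_def by auto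
  then show ?thesis by blast
qed

text \<open>A vertex \<open>r\<close> that leaves \<open>X\<close> joins the side opposite to the
  common colour \<open>c\<close> of its neighbours outside. Two vertices of \<open>R\<close> cannot
  conflict, since \<open>R\<close> is part of an independent set.\<close>

lemma admissible_exchange:
  assumes X: "admissible X" and R: "R \<subseteq> X" and A: "A \<subseteq> V - X"
    and indA: "\<And>x y. x \<in> A \<Longrightarrow> y \<in> A \<Longrightarrow> \<not> E x y"
    and AX: "\<And>x y. x \<in> A \<Longrightarrow> y \<in> X - R \<Longrightarrow> \<not> E x y"
    and g: "\<And>x y. E x y \<Longrightarrow> x \<notin> X \<union> A \<Longrightarrow> y \<notin> X \<union> A \<Longrightarrow> (g :: 'a \<Rightarrow> bool) x \<noteq> g y"
    and Rg: "\<And>r. r \<in> R \<Longrightarrow> \<exists>c. \<forall>y. E r y \<longrightarrow> y \<notin> X \<union> A \<longrightarrow> g y = c"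
  shows "admissible (X - R \<union> A)" "card R = card A \<Longrightarrow> card (X - R \<union> A) = card X"
    "card R < card A \<Longrightarrow> card X < card (X - R \<union> A)"
proof -
  have XV: "X \<subseteq> V" and indX: "\<And>x y. x \<in> X \<Longrightarrow> y \<in> X \<Longrightarrow> \<not> E x y"
    using X unfolding admissible_def by auto
  obtain c where c: "\<And>r y. r \<in> R \<Longrightarrow> E r y \<Longrightarrow> y \<notin> X \<union> A \<Longrightarrow> g y = c r"
    using Rg by metis
  define f where "f = (\<lambda>x. if x \<in> R then \<not> c x else g x)"
  have "f x \<noteq> f y" if e: "E x y" and xy: "x \<notin> X - R \<union> A" "y \<notin> X - R \<union> A" for x y
  proof -
    consider "x \<in> R" "y \<in> R" | "x \<in> R" "y \<notin> X \<union> A" | "y \<in> R" "x \<notin> X \<union> A" | "x \<notin> X \<union> A" "y \<notin> X \<union> A"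
      using xy by blast
    then show ?thesis
    proof cases
      case 1 then show ?thesis using indX e R by blast
    next
      case 2 then show ?thesis using c e R by (auto simp: f_def)
    next
      case 3 then show ?thesis using c E_sym[OF e] R by (auto simp: f_def)
    next
      case 4 then show ?thesis using g e R by (auto simp: f_def)
    qed
  qed
  moreover have "\<forall>x\<in>X - R \<union> A. \<forall>y\<in>X - R \<union> A. \<not> E x y"
    using indX indA AX E_sym by blast
  moreover have "X - R \<union> A \<subseteq> V" using XV A by blast
  ultimately show "admissible (X - R \<union> A)" unfolding admissible_def by blast
  have fX: "finite X" "finite A" using XV A fin_V finite_subset by (blast, blast)
  have "card (X - R \<union> A) = card (X - R) + card A"
    using fX A by (intro card_Un_disjoint) auto
  moreover have "card (X - R) = card X - card R"
    using R fX(1) by (meson card_Diff_subset finite_subset)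
  moreover have "card R \<le> card X" using R fX(1) by (rule card_mono[rotated])
  ultimately have "card (X - R \<union> A) = card X - card R + card A" "card R \<le> card X" by auto
  then show "card R = card A \<Longrightarrow> card (X - R \<union> A) = card X"
    "card R < card A \<Longrightarrow> card X < card (X - R \<union> A)" by auto
qed

text \<open>Palettes are numbered separately, so that disjointness can be checked palette by
  palette; they are shifted apart only at the end. The bound 15 is an inequality because isolated
  vertices simply keep everything that is left.\<close>

definition palette_colouring :: "('a \<Rightarrow> nat set) \<Rightarrow> ('a \<Rightarrow> bool \<Rightarrow> nat set) \<Rightarrow> bool" where
  "palette_colouring A B \<longleftrightarrow>
    (\<forall>v\<in>V. A v \<subseteq> {..<13} \<and> (\<forall>b. B v b \<subseteq> {..<15}) \<and>
      15 \<le> card (A v) + card (B v True) + card (B v False)) \<and>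
    (\<forall>x y. E x y \<longrightarrow> A x \<inter> A y = {} \<and> (\<forall>b. B x b \<inter> B y b = {}))"

end

section \<open>The complement of an optimal set\<close>

locale optimal_split = subcubic_triangle_free +
  fixes X :: "'a set" and f :: "'a \<Rightarrow> bool"
  assumes opt: "optimal X"
    and f: "E x y \<Longrightarrow> x \<notin> X \<Longrightarrow> y \<notin> X \<Longrightarrow> f x \<noteq> f y"
begin

abbreviation W :: "'a \<Rightarrow> 'a set" where "W \<equiv> inn X"
abbreviation M :: "'a \<Rightarrow> 'a set" where "M \<equiv> out X"

definition isolated :: "'a \<Rightarrow> bool" where "isolated h \<longleftrightarrow> h \<in> V \<and> h \<notin> X \<and> M h = {}"
definition leaf :: "'a \<Rightarrow> bool" where "leaf h \<longleftrightarrow> h \<notin> X \<and> card (M h) = 1"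
definition inner :: "'a \<Rightarrow> bool" where "inner h \<longleftrightarrow> h \<notin> X \<and> card (M h) = 2"

lemma adm: "admissible X" using opt unfolding optimal_def by blast

lemma X_V: "X \<subseteq> V" and X_indep: "x \<in> X \<Longrightarrow> y \<in> X \<Longrightarrow> \<not> E x y"
  using adm unfolding admissible_def by auto

lemma W_iff: "y \<in> W x \<longleftrightarrow> E x y \<and> y \<in> X" by (simp add: inn_def)
lemma M_iff: "y \<in> M x \<longleftrightarrow> E x y \<and> y \<notin> X" by (simp add: out_def)

lemma fin_W: "finite (W x)" unfolding inn_def by (rule finite_subset[OF _ fin_N[of x]]) auto
lemma fin_M: "finite (M x)" unfolding out_def by (rule finite_subset[OF _ fin_N[of x]]) auto

lemma card_W_M: "card (W x) + card (M x) \<le> 3"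
proof -
  have "W x \<union> M x = {y. E x y}" "W x \<inter> M x = {}" by (auto simp: W_iff M_iff)
  then have "card (W x) + card (M x) = card {y. E x y}"
    using card_Un_disjoint[OF fin_W fin_M, of x x] by simp
  then show ?thesis using deg3[of x] by simp
qed

lemma better:
  assumes "admissible Y"
  shows "\<not> card X < card Y"
    and "card Y = card X \<Longrightarrow> \<not> card (isos X) < card (isos Y)"
    and "card Y = card X \<Longrightarrow> card (isos X) \<le> card (isos Y) \<Longrightarrow> \<not> card (pairs X) < card (pairs Y)"
  using opt assms unfolding optimal_def by (force, force, force)

lemma fin_isos: "finite (isos Y)" "finite (pairs Y)"
  using fin_V by (auto simp: isos_def pairs_def)

text \<open>\<open>R\<close> leaves \<open>X\<close> and \<open>A\<close> enters. The colouring
  \<open>g\<close> is left free because some exchanges work only after \<open>f\<close> has been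
  flipped on a set that is closed under the remaining adjacency.\<close>

definition swap :: "'a set \<Rightarrow> 'a set \<Rightarrow> ('a \<Rightarrow> bool) \<Rightarrow> bool" where
  "swap R A g \<longleftrightarrow> R \<subseteq> X \<and> A \<subseteq> V - X \<and> (\<forall>x\<in>A. \<forall>y\<in>A. \<not> E x y) \<and> (\<forall>x\<in>A. W x \<subseteq> R) \<and>
     (\<forall>x y. E x y \<longrightarrow> x \<notin> X \<union> A \<longrightarrow> y \<notin> X \<union> A \<longrightarrow> g x \<noteq> g y) \<and>
     (\<forall>r\<in>R. \<exists>c. \<forall>y\<in>M r - A. g y = c)"

lemma swap:
  assumes "swap R A g"
  shows "card A \<le> card R"
    and "card A = card R \<Longrightarrow> card (isos (X - R \<union> A)) \<le> card (isos X)"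
    and "card A = card R \<Longrightarrow> card (isos X) \<le> card (isos (X - R \<union> A)) \<Longrightarrow>
      card (pairs (X - R \<union> A)) \<le> card (pairs X)"
proof -
  have s: "R \<subseteq> X" "A \<subseteq> V - X" "\<And>x y. x \<in> A \<Longrightarrow> y \<in> A \<Longrightarrow> \<not> E x y" "\<And>x. x \<in> A \<Longrightarrow> W x \<subseteq> R"
    "\<And>x y. E x y \<Longrightarrow> x \<notin> X \<union> A \<Longrightarrow> y \<notin> X \<union> A \<Longrightarrow> g x \<noteq> g y" "\<And>r. r \<in> R \<Longrightarrow> \<exists>c. \<forall>y\<in>M r - A. g y = c"
    using assms unfolding swap_def by auto
  have AX: "\<not> E x y" if "x \<in> A" "y \<in> X - R" for x y using s(4)[of x] that by (auto simp: W_iff)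
  have Rg: "\<exists>c. \<forall>y. E r y \<longrightarrow> y \<notin> X \<union> A \<longrightarrow> g y = c" if r: "r \<in> R" for r
  proof -
    obtain c where "\<forall>y\<in>M r - A. g y = c" using s(6)[OF r] by blast
    then show ?thesis by (intro exI[of _ c]) (simp add: M_iff)
  qed
  note ex = admissible_exchange[OF adm s(1,2,3) AX s(5) Rg]
  show "card A \<le> card R" using better(1)[OF ex(1)] ex(3) by linarith
  show "card A = card R \<Longrightarrow> card (isos (X - R \<union> A)) \<le> card (isos X)"
    using better(2)[OF ex(1)] ex(2) by simp
  show "card A = card R \<Longrightarrow> card (isos X) \<le> card (isos (X - R \<union> A)) \<Longrightarrow>
      card (pairs (X - R \<union> A)) \<le> card (pairs X)"
    using better(3)[OF ex(1)] ex(2) by simp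
qed

section \<open>Local structure of the complement\<close>

lemma const_on_small:
  assumes "finite S" "card S \<le> 1"
  shows "\<exists>c. \<forall>y\<in>S. g y = c"
proof (cases "S = {}")
  case False
  then have "card S = 1" using assms by (metis card_0_eq le_antisym less_one not_le)
  then show ?thesis by (auto simp: card_1_singleton_iff)
qed simp

text \<open>Otherwise \<open>h\<close> could enter \<open>X\<close> with nothing leaving it.\<close>

lemma W_nonempty:
  assumes "h \<in> V" "h \<notin> X"
  shows "W h \<noteq> {}"
proof
  assume "W h = {}"
  then have "swap {} {h} f" using assms E_irrefl f by (auto simp: swap_def)
  then show False using swap(1) by fastforce
qed

lemma M_V: "y \<in> M x \<Longrightarrow> x \<in> V \<and> y \<in> V" using E_V E_V2 by (auto simp: M_iff)

lemma card_M_le2: "h \<notin> X \<Longrightarrow> card (M h) \<le> 2"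
proof (cases "M h = {}")
  case False
  assume "h \<notin> X"
  then have "W h \<noteq> {}" using False M_V W_nonempty by blast
  then have "card (W h) > 0" using fin_W by (simp add: card_gt_0_iff)
  then show ?thesis using card_W_M[of h] by simp
qed auto

lemma trichotomy:
  assumes "h \<in> V" "h \<notin> X"
  shows "isolated h \<or> leaf h \<or> inner h"
proof -
  have "card (M h) = 0 \<or> card (M h) = 1 \<or> card (M h) = 2" using card_M_le2[OF assms(2)] by linarith
  then show ?thesis using assms fin_M by (auto simp: isolated_def leaf_def inner_def)
qed

lemma inner_W:
  assumes "inner h"
  obtains u where "W h = {u}"
proof -
  have "M h \<noteq> {}" "h \<notin> X" using assms by (auto simp: inner_def)
  then have "W h \<noteq> {}" using M_V W_nonempty by blast
  then have "card (W h) > 0" using fin_W by (simp add: card_gt_0_iff)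
  then have "card (W h) = 1" using card_W_M[of h] assms by (simp add: inner_def)
  then show thesis using that by (auto simp: card_1_singleton_iff)
qed

lemma leaf_W:
  assumes "leaf h"
  shows "card (W h) \<le> 2" "W h \<noteq> {}"
proof -
  have "M h \<noteq> {}" "h \<notin> X" using assms by (auto simp: leaf_def)
  then show "W h \<noteq> {}" using M_V W_nonempty by blast
  show "card (W h) \<le> 2" using card_W_M[of h] assms by (simp add: leaf_def)
qed

lemma leaf_W_cases:
  assumes "leaf h" "u \<in> W h"
  obtains "W h = {u}" | v where "W h = {u, v}" "v \<noteq> u"
proof (cases "W h = {u}")
  case False
  then obtain v where v: "v \<in> W h" "v \<noteq> u" using assms(2) by blast
  have "{u, v} = W h"
    using card_seteq[OF fin_W, of "{u, v}" h] leaf_W[OF assms(1)] v assms(2) by auto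
  then show thesis using that v by blast
qed

text \<open>Two such vertices could replace \<open>u\<close>: they are non-adjacent for lack of
  triangles, and \<open>u\<close> keeps at most one neighbour outside \<open>X\<close>, so some side
  accepts it.\<close>

lemma single_unique:
  assumes "W l = {u}" "W m = {u}"
  shows "l = m"
proof (rule ccontr)
  assume ne: "l \<noteq> m"
  have e: "E l u" "E m u" "u \<in> X" using assms by (auto simp: W_iff set_eq_iff)
  have lX: "l \<notin> X" "m \<notin> X" using e X_indep by auto
  have lm: "\<not> E l m" using no_tri[of l m u] e E_sym by blast
  have "{l, m} \<subseteq> M u" using e lX E_sym by (auto simp: M_iff)
  then have "card (M u - {l, m}) = card (M u) - 2" using ne by (subst card_Diff_subset) auto
  then have one: "\<exists>c. \<forall>y\<in>M u - {l, m}. f y = c"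
    using card_W_M[of u] fin_M by (intro const_on_small) auto
  have "swap {u} {l, m} f"
    using e lX lm E_V E_irrefl E_sym one f assms by (auto simp: swap_def)
  then show False using swap(1)[of "{u}" "{l, m}" f] ne by simp
qed

text \<open>The superset \<open>A'\<close> allows for entering vertices that are there on account of
  another leaving vertex.\<close>

lemma M_Diff_small:
  assumes "A \<subseteq> M u" "card A = 2"
  shows "\<exists>c. \<forall>y\<in>M u - A'. A \<subseteq> A' \<longrightarrow> g y = c"
proof -
  have "card (M u - A) = card (M u) - 2"
    using assms by (subst card_Diff_subset) (auto intro: finite_subset[OF _ fin_M])
  then have "\<exists>c. \<forall>y\<in>M u - A. g y = c"
    using card_W_M[of u] fin_M by (intro const_on_small) auto
  then show ?thesis by blast
qed

text \<open>Otherwise \<open>{h, l, m}\<close> is independent and could replace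
  \<open>{u, v}\<close>: \<open>u\<close> loses the neighbours \<open>h\<close> and
  \<open>l\<close>, \<open>v\<close> loses \<open>h\<close> and \<open>m\<close>, so each keeps at
  most one outside \<open>X\<close>.\<close>

lemma singles_adjacent:
  assumes h: "W h = {u, v}" "u \<noteq> v" and l: "W l = {u}" and m: "W m = {v}"
  shows "E l m"
proof (rule ccontr)
  assume lm: "\<not> E l m"
  have e: "E h u" "E h v" "E l u" "E m v" "u \<in> X" "v \<in> X" using assms by (auto simp: W_iff set_eq_iff)
  have nX: "h \<notin> X" "l \<notin> X" "m \<notin> X" using e X_indep by auto
  have ne: "l \<noteq> m" "h \<noteq> l" "h \<noteq> m" using assms by auto
  have "\<not> E h l" "\<not> E h m" using no_tri e E_sym by blast+
  then have ind: "\<forall>x\<in>{h, l, m}. \<forall>y\<in>{h, l, m}. \<not> E x y" using lm E_sym E_irrefl by auto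
  have "\<exists>c. \<forall>y\<in>M u - {h, l, m}. f y = c"
    using M_Diff_small[of "{h, l}" u "{h, l, m}" f] e nX ne E_sym by (auto simp: M_iff)
  moreover have "\<exists>c. \<forall>y\<in>M v - {h, l, m}. f y = c"
    using M_Diff_small[of "{h, m}" v "{h, l, m}" f] e nX ne E_sym by (auto simp: M_iff)
  ultimately have "swap {u, v} {h, l, m} f"
    using e nX ind E_V f assms unfolding swap_def by auto
  then show False using swap(1)[of "{u, v}" "{h, l, m}" f] ne h(2) by simp
qed

section \<open>Rigid leaves and the tie-breaking criteria\<close>

definition leaves :: "'a \<Rightarrow> 'a set" where "leaves l = {h \<in> M l. leaf h}"

text \<open>
  If \<open>a\<close> is not rigid, then moving \<open>l\<close> into \<open>X\<close> leaves \<open>a\<close> in a component with at most three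
  vertices; it misses the neighbours of \<open>u\<close> on the other side, so its two sides can be exchanged.
\<close>

definition rigid :: "'a \<Rightarrow> 'a \<Rightarrow> bool" where
  "rigid a l \<longleftrightarrow> (\<exists>p q r. M a = {p} \<and> q \<in> M p \<and> q \<noteq> a \<and> q \<noteq> l \<and> r \<in> M q \<and> r \<noteq> p \<and> r \<noteq> l)"

lemma M_sym: "x \<notin> X \<Longrightarrow> y \<in> M x \<Longrightarrow> x \<in> M y" using E_sym by (auto simp: M_iff)

lemma leaf_M: "leaf z \<Longrightarrow> y \<in> M z \<Longrightarrow> M z = {y}"
  by (auto simp: leaf_def card_1_singleton_iff)

lemma f_M: "x \<notin> X \<Longrightarrow> y \<in> M x \<Longrightarrow> f y \<noteq> f x" using f by (fastforce simp: M_iff)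

lemma two_elem:
  assumes "finite S" "card S \<le> 2" "x \<in> S" "y \<in> S" "x \<noteq> y"
  shows "S = {x, y}"
  using card_seteq[of S "{x, y}"] assms by auto

lemma three_elem:
  assumes "finite S" "card S \<le> 3" "x \<in> S" "y \<in> S" "z \<in> S" "x \<noteq> y" "x \<noteq> z" "y \<noteq> z"
  shows "S = {x, y, z}"
  using card_seteq[of S "{x, y, z}"] assms by auto

lemma flippable:
  assumes u: "u \<in> X" "a \<in> M u" "b \<in> M u" "f a \<noteq> f b"
    and a: "isolated a \<or> leaf a \<and> \<not> rigid a l" and l: "l \<in> M u"
  obtains S where "a \<in> S" "b \<notin> S" "\<And>x y. x \<in> S \<Longrightarrow> y \<in> M x \<Longrightarrow> y \<noteq> l \<Longrightarrow> y \<in> S"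
proof (cases "isolated a")
  case True
  then show thesis using that[of "{a}"] u(4) by (auto simp: isolated_def)
next
  case False
  then have a: "leaf a" "\<not> rigid a l" using a by auto
  then obtain p where p: "M a = {p}" by (auto simp: leaf_def card_1_singleton_iff)
  have nX: "a \<notin> X" "p \<notin> X" "b \<notin> X" using u p by (auto simp: M_iff set_eq_iff)
  have pa: "a \<in> M p" using M_sym nX p by blast
  have bp: "b \<noteq> p" "b \<noteq> a"
    using u no_tri[of u a p] E_sym[of u p] p by (auto simp: M_iff set_eq_iff)
  show thesis
  proof (cases "M p \<subseteq> {a, l}")
    case True
    then show thesis using that[of "{a, p}"] bp p by auto
  next
    case False
    then obtain q where q: "q \<in> M p" "q \<noteq> a" "q \<noteq> l" by blast
    then have Mp: "M p = {a, q}" using two_elem[OF fin_M card_M_le2] nX pa by auto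
    have "q \<notin> X" using q by (simp add: M_iff)
    have "M q \<subseteq> {p, l}" using a(2) p q unfolding rigid_def by blast
    \<comment> \<open>Two steps along the path lead back to the side of \<open>a\<close>, whereas
      \<open>b\<close> lies on the other side.\<close>
    moreover have "b \<noteq> q" using f_M[OF nX(2) q(1)] f_M[OF nX(2) pa] u(4) by auto
    ultimately show thesis using that[of "{a, p, q}"] bp p Mp by auto
  qed
qed

lemma flip_proper:
  assumes "\<And>x y. x \<in> S \<Longrightarrow> y \<in> M x \<Longrightarrow> y \<notin> A \<Longrightarrow> y \<in> S"
    and "E x y" "x \<notin> X \<union> A" "y \<notin> X \<union> A"
  shows "(f x \<noteq> (x \<in> S)) \<noteq> (f y \<noteq> (y \<in> S))"
proof -
  have "x \<in> S \<longleftrightarrow> y \<in> S" using assms E_sym by (auto simp: M_iff)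
  then show ?thesis using f[of x y] assms by auto
qed

lemma M_X: "u \<in> X \<Longrightarrow> card (M u) \<le> 3" using card_W_M[of u] by simp

text \<open>Replacing \<open>u\<close> by \<open>l\<close> would isolate all leaves at
  \<open>l\<close> and spoil only the isolated neighbours of \<open>u\<close>; by \<open>few\<close>
  this is a gain, so the exchange must be impossible. Hence the other neighbours of \<open>u\<close>
  occupy both sides, and no flip can bring them to one side, which forces them to be rigid
  leaves.\<close>

lemma support_dichotomy:
  assumes l: "inner l" "W l = {u}" and few: "card {z \<in> M u. isolated z} < card (leaves l)"
  obtains a g where "M u = {l, a, g}" "leaf a" "leaf g" "f a = f l" "f g \<noteq> f l"
    "rigid a l" "rigid g l" "a \<noteq> g"
proof -
  have lX: "l \<notin> X" and eu: "E l u" and uX: "u \<in> X"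
    using l by (auto simp: inner_def W_iff set_eq_iff)
  have lM: "l \<in> M u" using lX eu E_sym by (auto simp: M_iff)
  have nsw: "\<not> swap {u} {l} g" for g
  proof
    assume sw: "swap {u} {l} g"
    define Y where "Y = X - {u} \<union> {l}"
    define Z where "Z = {z \<in> M u. isolated z}"
    have "isos X - Z \<union> leaves l \<subseteq> isos Y"
    proof
      fix z assume "z \<in> isos X - Z \<union> leaves l"
      then show "z \<in> isos Y"
      proof
        assume z: "z \<in> isos X - Z"
        then have "z \<in> V" "z \<notin> X" "M z = {}" by (auto simp: isos_def)
        moreover then have "z \<notin> M u" using z by (auto simp: Z_def isolated_def)
        moreover have "z \<noteq> l" using calculation l by (auto simp: inner_def)
        ultimately show ?thesis using E_sym
          by (auto simp: isos_def Y_def out_def)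
      next
        assume z: "z \<in> leaves l"
        then have zl: "z \<in> M l" "leaf z" by (auto simp: leaves_def)
        then have Mz: "M z = {l}" using leaf_M M_sym[OF lX] by blast
        moreover have "z \<in> V" "z \<notin> X" "z \<noteq> l" using zl E_V2 E_irrefl by (auto simp: M_iff)
        moreover have "\<not> E z u" using no_tri[of z u l] zl eu E_sym by (auto simp: M_iff)
        ultimately show ?thesis
          by (auto simp: isos_def Y_def out_def set_eq_iff)
      qed
    qed
    then have "card (isos X - Z \<union> leaves l) \<le> card (isos Y)" using fin_isos card_mono by blast
    moreover have "card (isos X - Z \<union> leaves l) = card (isos X - Z) + card (leaves l)"
      using fin_isos fin_M by (intro card_Un_disjoint) (auto simp: leaves_def isos_def leaf_def)
    moreover have "card (isos X) - card Z \<le> card (isos X - Z)"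
      using fin_M by (intro diff_card_le_card_Diff) (auto simp: Z_def)
    moreover have "card Z \<le> card (isos X)"
      using fin_isos by (intro card_mono) (auto simp: Z_def isos_def isolated_def)
    ultimately have "card (isos X) < card (isos Y)" using few unfolding Z_def by linarith
    then show False using swap(2)[OF sw] Y_def by simp
  qed
  have swI: "swap {u} {l} g" if "\<And>x y. E x y \<Longrightarrow> x \<notin> X \<union> {l} \<Longrightarrow> y \<notin> X \<union> {l} \<Longrightarrow> g x \<noteq> g y"
    "\<exists>c. \<forall>y\<in>M u - {l}. g y = c" for g
    using that uX lX l(2) E_V[OF eu] E_irrefl by (auto simp: swap_def)
  have "\<not> (\<exists>c. \<forall>y\<in>M u - {l}. f y = c)" using nsw swI[of f] f by blast
  then obtain a0 b0 where ab0: "a0 \<in> M u - {l}" "b0 \<in> M u - {l}" "f a0 \<noteq> f b0" by blast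
  define a where "a = (if f a0 = f l then a0 else b0)"
  define b where "b = (if f a0 = f l then b0 else a0)"
  have ab: "a \<in> M u" "a \<noteq> l" "b \<in> M u" "b \<noteq> l" "f a = f l" "f b \<noteq> f l"
    using ab0 by (auto simp: a_def b_def)
  have Mu: "M u = {l, a, b}"
    by (rule three_elem[OF fin_M M_X[OF uX]]) (use ab lM in auto)
  have rig: "leaf x \<and> rigid x l" if x: "x \<in> M u" "y \<in> M u" "f x \<noteq> f y" "{x, y} = {a, b}" for x y
  proof (rule ccontr)
    assume n: "\<not> (leaf x \<and> rigid x l)"
    have "x \<in> V" "x \<notin> X" using x(1) M_V by (auto simp: M_iff)
    moreover have "\<not> inner x"
    proof
      assume "inner x"
      then obtain v where v: "W x = {v}" by (rule inner_W)
      have "u \<in> W x" using x(1) E_sym uX by (auto simp: M_iff W_iff)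
      then have "x = l" using v single_unique l(2) by auto
      then show False using x ab by auto
    qed
    ultimately have "isolated x \<or> leaf x \<and> \<not> rigid x l" using trichotomy n by blast
    then obtain S where S: "x \<in> S" "y \<notin> S" "\<And>x y. x \<in> S \<Longrightarrow> y \<in> M x \<Longrightarrow> y \<noteq> l \<Longrightarrow> y \<in> S"
      using flippable[OF uX x(1,2,3) _ lM] by metis
    define g where "g = (\<lambda>z. f z \<noteq> (z \<in> S))"
    have "swap {u} {l} g"
    proof (rule swI)
      show "g z \<noteq> g z'" if "E z z'" "z \<notin> X \<union> {l}" "z' \<notin> X \<union> {l}" for z z'
        using flip_proper[of S "{l}" z z'] S(3) that by (auto simp: g_def)
      have "g x = g y" using S x by (auto simp: g_def)
      moreover have "M u - {l} = {x, y}" using Mu x(4) ab by auto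
      ultimately show "\<exists>c. \<forall>y\<in>M u - {l}. g y = c" by auto
    qed
    then show False using nsw by blast
  qed
  have "leaf a \<and> rigid a l" "leaf b \<and> rigid b l"
    using rig[of a b] rig[of b a] ab by auto
  then show thesis using that[of a b] Mu ab by auto
qed

text \<open>Suppose not. Exchanging \<open>{u, w}\<close> for \<open>{a, l}\<close> isolates
  \<open>h\<close>, and it is possible as soon as \<open>m\<close> and \<open>z\<close> can be
  brought to one side, if need be by flipping a two-vertex component of \<open>z\<close>. Otherwise
  exchanging \<open>w\<close> for \<open>m\<close> keeps all isolated vertices and turns
  \<open>l\<close>, \<open>h\<close> into a new two-vertex component, so the last criterion
  decides.\<close>

lemma strong_other:
  assumes l: "inner l" "W l = {u}" and h: "h \<in> leaves l"
    and u: "M u = {l, a, g}" "leaf a" "leaf g" "f a = f l" "f g \<noteq> f l" "rigid a l"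
    and a: "W a = {u, w}" "w \<noteq> u"
    and m: "inner m" "W m = {w}" "f m \<noteq> f a"
    and w: "M w = {a, m, z}" "leaf z" "z \<noteq> a"
  shows "z = h"
proof (rule ccontr)
  assume zh: "z \<noteq> h"
  have nX: "l \<notin> X" "a \<notin> X" "g \<notin> X" "m \<notin> X" "z \<notin> X" "h \<notin> X" and hl: "h \<in> M l" "leaf h"
    using l u m w h by (auto simp: inner_def leaf_def leaves_def M_iff)
  have e: "E u l" "E u a" "E u g" "E w a" "E w m" "E w z" "E l h" "u \<in> X" "w \<in> X"
    using u(1) w(1) hl a(1) by (auto simp: M_iff W_iff set_eq_iff)
  have lm: "E l m" using singles_adjacent[OF a(1) _ l(2) m(2)] a(2) by blast
  have Ml: "M l = {h, m}"
  proof (rule two_elem[OF fin_M])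
    show "h \<noteq> m" using hl m(1) by (auto simp: inner_def leaf_def)
  qed (use l hl lm nX in \<open>auto simp: inner_def M_iff\<close>)
  have Mh: "M h = {l}" using leaf_M hl M_sym nX by blast
  have fh: "f h \<noteq> f l" using f_M nX hl by blast
  have ha: "h \<noteq> a" "h \<noteq> m" using fh u(4) hl m(1) by (auto simp: inner_def leaf_def)
  have hw: "\<not> E h w" using w(1) ha zh nX(6) E_sym by (auto simp: M_iff set_eq_iff)
  have hu: "\<not> E h u" using no_tri[of h u l] e by blast
  have noiso: "\<not> isolated x" if "x \<in> M u \<union> M w" for x
    using that u w m(1) l(1) by (auto simp: isolated_def leaf_def inner_def)
  have ne: "a \<noteq> l" "m \<noteq> z" "g \<noteq> l" "g \<noteq> a" using u(2) l(1) m(1) w(2) u(4,5) by (auto simp: inner_def leaf_def)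
  have al: "\<not> E a l" using no_tri[of a l u] e E_sym by blast
  have first: False if g': "\<And>x y. E x y \<Longrightarrow> x \<notin> X \<union> {a, l} \<Longrightarrow> y \<notin> X \<union> {a, l} \<Longrightarrow> g' x \<noteq> g' y" "g' m = g' z"
    for g' :: "'a \<Rightarrow> bool"
  proof -
    have "M u - {a, l} = {g}" "M w - {a, l} \<subseteq> {m, z}" using u(1) w(1) ne by auto
    then have "\<exists>c. \<forall>y\<in>M u - {a, l}. g' y = c" "\<exists>c. \<forall>y\<in>M w - {a, l}. g' y = c" using g'(2) by auto
    moreover have "\<forall>x\<in>{a, l}. \<forall>y\<in>{a, l}. \<not> E x y" using al E_sym E_irrefl by auto
    ultimately have sw: "swap {u, w} {a, l} g'"
      using g'(1) e nX E_V2 l(2) a(1) unfolding swap_def by auto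
    define Y where "Y = X - {u, w} \<union> {a, l}"
    have "insert h (isos X) \<subseteq> isos Y"
    proof
      fix x assume "x \<in> insert h (isos X)"
      then show "x \<in> isos Y"
      proof
        assume "x = h"
        moreover have "h \<in> V" "h \<noteq> l" using e E_V2 E_irrefl by auto
        ultimately show ?thesis using Mh hu hw nX ha
          by (auto simp: isos_def Y_def out_def set_eq_iff)
      next
        assume x: "x \<in> isos X"
        then have "x \<in> V" "x \<notin> X" "M x = {}" by (auto simp: isos_def)
        moreover then have "x \<notin> M u \<union> M w" using noiso by (auto simp: isolated_def)
        ultimately show ?thesis using u(1) E_sym
          by (auto simp: isos_def Y_def out_def)
      qed
    qed
    moreover have "h \<notin> isos X" using Mh by (auto simp: isos_def)
    ultimately have "card (isos X) < card (isos Y)"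
      using fin_isos by (intro psubset_card_mono) auto
    then show False using swap(2)[OF sw] Y_def ne a(2) by simp
  qed
  show False
  proof (cases "f z = f m")
    case True
    then show False using first[of f] f by auto
  next
    case False
    then have fz: "f z = f a" using m(3) by auto
    show False
    proof (cases "z \<in> pairs X")
      case True
      then obtain p where p: "M z = {p}" "M p = {z}" by (auto simp: pairs_def)
      have "m \<noteq> p" using no_tri[of w z m] e p E_sym by (auto simp: M_iff set_eq_iff)
      then have "(f m \<noteq> (m \<in> {z, p})) = (f z \<noteq> (z \<in> {z, p}))" using ne fz m(3) by auto
      then show False
        using first[of "\<lambda>x. f x \<noteq> (x \<in> {z, p})"] flip_proper[of "{z, p}" "{a, l}"] p by auto
    next
      case zp: False
      have sw: "swap {w} {m} f"
      proof -
        have "M w - {m} \<subseteq> {a, z}" using w(1) by auto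
        then have "\<exists>c. \<forall>y\<in>M w - {m}. f y = c" using fz by auto
        then show ?thesis using e nX E_V2 m(2) E_irrefl f unfolding swap_def by auto
      qed
      define Y where "Y = X - {w} \<union> {m}"
      have iso: "isos X \<subseteq> isos Y"
      proof
        fix x assume x: "x \<in> isos X"
        then have "x \<in> V" "x \<notin> X" "M x = {}" by (auto simp: isos_def)
        moreover then have "x \<notin> M u \<union> M w" using noiso by (auto simp: isolated_def)
        ultimately show "x \<in> isos Y" using w(1) E_sym
          by (auto simp: isos_def Y_def out_def)
      qed
      have outY: "out Y x = M x - {m}" if "\<not> E x w" for x
        using that by (auto simp: Y_def out_def)
      have lw: "\<not> E l w" using l(2) a(2) e by (auto simp: W_iff set_eq_iff)
      have ap: "a \<notin> pairs X" using u(6) by (auto simp: rigid_def pairs_def)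
      \<comment> \<open>A two-vertex component could be lost only through \<open>m\<close> or a
        neighbour of \<open>w\<close>; but \<open>a\<close> is rigid, \<open>m\<close> is inner, and
        \<open>z\<close> is excluded by the case.\<close>
      have "insert l (pairs X) \<subseteq> pairs Y"
      proof
        fix x assume "x \<in> insert l (pairs X)"
        then show "x \<in> pairs Y"
        proof
          assume "x = l"
          moreover have "out Y l = {h}" "out Y h = {l}"
            using outY lw hw Ml Mh ha lm E_irrefl by auto
          moreover have "l \<in> V - Y" using e E_V2 nX lm E_irrefl by (auto simp: Y_def)
          ultimately show ?thesis by (auto simp: pairs_def)
        next
          assume x: "x \<in> pairs X"
          then obtain y where y: "M x = {y}" "M y = {x}" "x \<in> V" "x \<notin> X" by (auto simp: pairs_def)
          have yp: "y \<in> pairs X" using y E_V2 by (auto simp: pairs_def M_iff set_eq_iff)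
          have "m \<notin> pairs X" using m(1) by (auto simp: pairs_def inner_def)
          then have "x \<noteq> m" "y \<noteq> m" "x \<notin> M w" "y \<notin> M w" using x yp zp ap w(1) by auto
          moreover have "y \<notin> X" using yp by (simp add: pairs_def)
          ultimately have "\<not> E x w" "\<not> E y w" and xm: "x \<noteq> m" "y \<noteq> m"
            using y(4) E_sym by (auto simp: M_iff)
          then have "out Y x = {y}" "out Y y = {x}" using outY y(1,2) by auto
          moreover have "x \<in> V - Y" using y xm by (auto simp: Y_def)
          ultimately have "out Y x = {y}" "out Y y = {x}" "x \<in> V - Y" by auto
          then show ?thesis by (auto simp: pairs_def)
        qed
      qed
      moreover have "l \<notin> pairs X" using l(1) by (auto simp: pairs_def inner_def)
      ultimately have "card (pairs X) < card (pairs Y)"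
        using fin_isos by (intro psubset_card_mono) auto
      moreover have "card (isos X) \<le> card (isos Y)" using iso fin_isos card_mono by blast
      ultimately show False using swap(3)[OF sw] Y_def by simp
    qed
  qed
qed

end

section \<open>Colours borrowed by vertices without support neighbours\<close>

context optimal_split
begin

definition support :: "'a \<Rightarrow> bool" where
  "support l \<longleftrightarrow> inner l \<and> leaves l \<noteq> {}"

text \<open>The vertex \<open>u\<close> will borrow all of \<open>D g\<close>, and from the palette
  of \<open>l\<close> a few colours that \<open>a\<close> and \<open>l\<close> both give up.\<close>

definition two_sided :: "'a \<Rightarrow> 'a \<Rightarrow> 'a \<Rightarrow> 'a \<Rightarrow> bool" where
  "two_sided u l a g \<longleftrightarrow> support l \<and> W l = {u} \<and> a \<in> M u \<and> leaf a \<and> f a = f l \<and>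
     g \<in> M u \<and> leaf g \<and> f g \<noteq> f l"

text \<open>With the only leaf \<open>y\<close> opposite to \<open>l\<close>, the vertex
  \<open>u\<close> will borrow two colours of \<open>D y\<close> and all of
  \<open>\<Delta> l\<close>.\<close>

definition one_sided :: "'a \<Rightarrow> 'a \<Rightarrow> 'a \<Rightarrow> bool" where
  "one_sided u l y \<longleftrightarrow> support l \<and> W l = {u} \<and> y \<in> M u \<and> leaf y \<and> f y \<noteq> f l \<and>
     (\<forall>h\<in>M u. leaf h \<longrightarrow> h = y)"

text \<open>Here \<open>l\<close> gives up nothing, so \<open>u\<close> must borrow both missing
  colours from the other palette. With two leaves around, this is settled in advance; with one leaf
  it can wait.\<close>

definition tied :: "'a \<Rightarrow> 'a \<Rightarrow> bool" where
  "tied u l \<longleftrightarrow> inner l \<and> \<not> support l \<and> W l = {u} \<and> (\<exists>y\<in>M u. leaf y \<and> f y \<noteq> f l) \<and>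
     (\<exists>x\<in>M u. \<exists>y\<in>M u. leaf x \<and> leaf y \<and> x \<noteq> y)"

text \<open>Such a vertex will borrow one colour from each palette.\<close>

definition mixed :: "'a \<Rightarrow> bool" where
  "mixed u \<longleftrightarrow> u \<in> X \<and> (\<forall>h\<in>M u. \<not> inner h) \<and> (\<forall>b. \<exists>h\<in>M u. leaf h \<and> f h = b)"

lemma inner_owner:
  assumes "inner l" "l \<in> M u" "u \<in> X"
  shows "W l = {u}"
proof -
  obtain v where "W l = {v}" using inner_W[OF assms(1)] .
  moreover have "u \<in> W l" using assms E_sym by (auto simp: M_iff W_iff)
  ultimately show ?thesis by simp
qed

lemma inner_unique: "inner l \<Longrightarrow> inner m \<Longrightarrow> l \<in> M u \<Longrightarrow> m \<in> M u \<Longrightarrow> u \<in> X \<Longrightarrow> l = m"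
  using inner_owner[of l u] inner_owner[of m u] single_unique[of l u m] by simp

lemma owner_M:
  assumes "W l = {u}" "l \<notin> X"
  shows "u \<in> X" "l \<in> M u" "E l u"
  using assms E_sym by (auto simp: W_iff M_iff set_eq_iff)

lemma W_M: "l \<notin> X \<Longrightarrow> u \<in> W l \<longleftrightarrow> u \<in> X \<and> l \<in> M u"
  using E_sym by (auto simp: W_iff M_iff)

lemma leaf_X: "leaf h \<Longrightarrow> h \<notin> X" and inner_X: "inner h \<Longrightarrow> h \<notin> X"
  by (auto simp: leaf_def inner_def)

lemma inner_not_leaf: "inner h \<Longrightarrow> \<not> leaf h" by (auto simp: inner_def leaf_def)

lemma leaf_ex: "leaf h \<Longrightarrow> \<exists>s. M h = {s}"
  by (auto simp: leaf_def card_1_singleton_iff)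

lemma M_not_X: "y \<in> M x \<Longrightarrow> y \<notin> X" by (simp add: M_iff)

text \<open>The engine of the uniqueness arguments below: the vertices owned by two neighbours of
  one leaf are on opposite sides, so the two owners cannot put the same kind of demand on that
  leaf.\<close>

lemma two_owners:
  assumes "leaf h" "u \<in> W h" "v \<in> W h" "u \<noteq> v" "W l = {u}" "W m = {v}" "l \<notin> X" "m \<notin> X"
  shows "E l m" "f l \<noteq> f m"
proof -
  have "{u, v} = W h"
    using card_seteq[OF fin_W, of "{u, v}" h] leaf_W(1)[OF assms(1)] assms(2,3,4) by simp
  then show e: "E l m" using singles_adjacent[OF _ assms(4,5,6), of h] by simp
  show "f l \<noteq> f m" using f[OF e assms(7,8)] .
qed

text \<open>The three neighbours of \<open>u\<close> are used up, none of them isolated, so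
  \<open>support_dichotomy\<close> applies, and the leaves it provides must be \<open>a\<close> and
  \<open>g\<close>.\<close>

lemma two_sidedD:
  assumes "two_sided u l a g"
  shows "inner l" "support l" "W l = {u}" "leaf a" "leaf g" "f a = f l" "f g \<noteq> f l" "u \<in> X"
    "M u = {l, a, g}" "a \<noteq> g" "a \<noteq> l" "g \<noteq> l" "u \<in> W a" "u \<in> W g" "rigid a l" "rigid g l"
proof -
  have b: "support l" "W l = {u}" "a \<in> M u" "leaf a" "f a = f l" "g \<in> M u" "leaf g" "f g \<noteq> f l"
    using assms by (auto simp: two_sided_def)
  have i: "inner l" using b by (simp add: support_def)
  have u: "u \<in> X" "l \<in> M u" using owner_M[OF b(2)] inner_X[OF i] by auto
  have ne: "a \<noteq> g" "a \<noteq> l" "g \<noteq> l" using b inner_not_leaf[OF i] by auto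
  have M: "M u = {l, a, g}" using three_elem[OF fin_M M_X[OF u(1)]] u b ne by blast
  have "{z \<in> M u. isolated z} = {}"
    using M b i by (auto simp: isolated_def leaf_def inner_def)
  moreover have "card (leaves l) > 0"
    using b(1) fin_M by (auto simp: support_def leaves_def card_gt_0_iff)
  ultimately have "card {z \<in> M u. isolated z} < card (leaves l)" by (simp only: card.empty)
  then obtain a' g' where ag: "M u = {l, a', g'}" "leaf a'" "leaf g'" "f a' = f l" "f g' \<noteq> f l"
    "rigid a' l" "rigid g' l"
    using support_dichotomy[OF i b(2)] by metis
  have "a' = a" "g' = g" using ag M b ne inner_not_leaf[OF i] by (metis insertCI insertE singletonD)+
  with b i u M ne ag show "inner l" "support l" "W l = {u}" "leaf a" "leaf g" "f a = f l" "f g \<noteq> f l" "u \<in> X"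
    "M u = {l, a, g}" "a \<noteq> g" "a \<noteq> l" "g \<noteq> l" "rigid a l" "rigid g l"
    by auto
  show "u \<in> W a" "u \<in> W g" using b u W_M leaf_X by blast+
qed

lemma two_sided_same_owner:
  assumes "two_sided u l a g" "two_sided u l' a' g'"
  shows "l' = l \<and> a' = a \<and> g' = g"
proof -
  note d = two_sidedD[OF assms(1)] and d' = two_sidedD[OF assms(2)]
  have "l' = l" using single_unique[OF d'(3) d(3)] .
  moreover have "a' \<in> {l, a, g}" "g' \<in> {l, a, g}" using d(9) d'(9) by auto
  ultimately show ?thesis using d d' by auto
qed

text \<open>Two owners giving a leaf the same role would have supports on the same side, against
  \<open>two_owners\<close>.\<close>

lemma two_sided_same_leaf:
  assumes "two_sided u l a g" "two_sided v m b k"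
  shows "a = b \<Longrightarrow> u = v" "g = k \<Longrightarrow> u = v" "l = m \<Longrightarrow> u = v"
proof -
  note d = two_sidedD[OF assms(1)] and d' = two_sidedD[OF assms(2)]
  show "a = b \<Longrightarrow> u = v" using two_owners(2)[of a u v l m] d(3,4,6,13) d'(3,6,13) inner_X[OF d(1)] inner_X[OF d'(1)] by auto
  show "g = k \<Longrightarrow> u = v" using two_owners(2)[of g u v l m] d(3,5,7,14) d'(3,7,14) inner_X[OF d(1)] inner_X[OF d'(1)] by auto
  show "l = m \<Longrightarrow> u = v" using d(3) d'(3) by auto
qed

text \<open>By rigidity the path from \<open>x\<close> continues beyond \<open>p\<close>.\<close>

lemma two_sided_poor:
  assumes "two_sided u l a g" "x = a \<or> x = g" "M x = {p}"
  shows "inner p"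
proof -
  note d = two_sidedD[OF assms(1)]
  have "rigid x l" "leaf x" using assms(2) d by auto
  then obtain q where q: "q \<in> M p" "q \<noteq> x" using assms(3) by (auto simp: rigid_def)
  have pX: "p \<notin> X" using assms(3) M_not_X by blast
  have "x \<in> M p" using M_sym[of x p] assms(3) leaf_X[OF \<open>leaf x\<close>] by auto
  then have "M p = {x, q}" using two_elem[OF fin_M card_M_le2[OF pX]] q by auto
  then show ?thesis using q pX by (auto simp: inner_def)
qed

lemma tiedD:
  assumes "tied u l"
  shows "inner l" "\<not> support l" "W l = {u}" "u \<in> X" "l \<in> M u"
proof -
  show *: "inner l" "\<not> support l" "W l = {u}" using assms by (auto simp: tied_def)
  show "u \<in> X" "l \<in> M u" using owner_M[OF *(3) inner_X[OF *(1)]] by auto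
qed

lemma tied_unique: "tied u l \<Longrightarrow> tied u m \<Longrightarrow> l = m"
  by (rule single_unique) (auto dest: tiedD(3))

lemma tied_not_mixed: "tied u l \<Longrightarrow> \<not> mixed u"
  using tiedD(1,5)[of u l] by (auto simp: mixed_def)

lemma two_sided_not:
  assumes "two_sided u l a g"
  shows "\<not> tied u m" "\<not> mixed u" "\<not> one_sided u m y"
proof -
  note d = two_sidedD[OF assms]
  show "\<not> tied u m" using tiedD(2,3)[of u m] single_unique[of l u m] d(2,3) by auto
  show "\<not> mixed u" using d by (auto simp: mixed_def)
  show "\<not> one_sided u m y" using d by (auto simp: one_sided_def)
qed

definition node :: "'a \<Rightarrow> bool" where "node u \<longleftrightarrow> mixed u \<or> (\<exists>l. tied u l)"

lemma node_X: "node u \<Longrightarrow> u \<in> X" using tiedD(4)[of u] by (auto simp: node_def mixed_def)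

text \<open>Each node has two slots of one colour each; the Boolean numbers the slots and need not
  be the palette. Slots across a two-vertex component must differ because each end takes what the
  other gives up.\<close>

definition clash :: "'a \<times> bool \<Rightarrow> 'a \<times> bool \<Rightarrow> bool" where
  "clash x y \<longleftrightarrow> fst x = fst y \<and> snd x \<noteq> snd y \<or>
     (\<exists>h s. leaf h \<and> leaf s \<and> M h = {s} \<and> fst x \<in> W h \<and> fst y \<in> W s)"

lemma clash_sym: "clash x y \<Longrightarrow> clash y x"
proof -
  have "M s = {h}" if "leaf h" "leaf s" "M h = {s}" for h s
    using leaf_M that M_sym leaf_X by blast
  then show "clash x y \<Longrightarrow> clash y x" unfolding clash_def by metis
qed

lemma clash_irrefl: "\<not> clash x x"
proof
  assume "clash x x"
  then obtain h s where "M h = {s}" "fst x \<in> W h" "fst x \<in> W s" by (auto simp: clash_def)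
  then show False using no_tri[of h s "fst x"] E_sym by (auto simp: M_iff W_iff set_eq_iff)
qed

text \<open>The other slot of \<open>u\<close>, and for each of at most three leaves the two slots
  of at most two neighbours of its partner: 1 + 3 * 2 * 2 = 13.\<close>

lemma card_clash:
  assumes "u \<in> X"
  shows "finite {y. clash (u, k) y}" "card {y. clash (u, k) y} \<le> 13"
proof -
  define P where "P h = (if leaf h then \<Union>s\<in>{s\<in>M h. leaf s}. W s \<times> UNIV else {} :: ('a \<times> bool) set)" for h
  have P: "finite (P h) \<and> card (P h) \<le> 4" for h
  proof (cases "leaf h \<and> (\<exists>s\<in>M h. leaf s)")
    case True
    then obtain s where s: "s \<in> M h" "leaf s" by blast
    then have "{s\<in>M h. leaf s} = {s}" using leaf_M True by blast
    then have "P h = W s \<times> UNIV" using True by (auto simp: P_def)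
    then show ?thesis using leaf_W(1)[OF s(2)] fin_W by (simp add: card_cartesian_product)
  next
    case False
    then have "P h = {}" by (auto simp: P_def)
    then show ?thesis by simp
  qed
  have sub: "{y. clash (u, k) y} \<subseteq> {(u, \<not> k)} \<union> (\<Union>h\<in>M u. P h)"
  proof
    fix y assume "y \<in> {y. clash (u, k) y}"
    then have c: "clash (u, k) y" by simp
    show "y \<in> {(u, \<not> k)} \<union> (\<Union>h\<in>M u. P h)"
    proof (cases "u = fst y \<and> k \<noteq> snd y")
      case True
      then have "y = (u, \<not> k)" by (auto simp: prod_eq_iff)
      then show ?thesis by simp
    next
      case False
      then obtain h s where h: "leaf h" "leaf s" "M h = {s}" "u \<in> W h" "fst y \<in> W s"
        using c by (auto simp: clash_def)
      then have "h \<in> M u" using W_M leaf_X by blast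
      moreover have "y \<in> P h" using h by (cases y) (auto simp: P_def)
      ultimately show ?thesis by blast
    qed
  qed
  have fin: "finite ({(u, \<not> k)} \<union> (\<Union>h\<in>M u. P h))" using fin_M P by auto
  then show "finite {y. clash (u, k) y}" using sub finite_subset by blast
  have "card (\<Union>h\<in>M u. P h) \<le> (\<Sum>h\<in>M u. card (P h))" using fin_M by (rule card_UN_le)
  also have "\<dots> \<le> (\<Sum>h\<in>M u. 4)" by (rule sum_mono) (use P in auto)
  also have "\<dots> \<le> 12" using M_X[OF assms] by simp
  finally have "card ({(u, \<not> k)} \<union> (\<Union>h\<in>M u. P h)) \<le> 13"
    using card_Un_le[of "{(u, \<not> k)}" "\<Union>h\<in>M u. P h"] by simp
  then show "card {y. clash (u, k) y} \<le> 13" using card_mono[OF fin sub] by simp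
qed

lemma node_palette_exists:
  "\<exists>cols :: 'a \<Rightarrow> bool \<Rightarrow> nat set.
    (\<forall>u b. cols u b \<subseteq> {..<15} \<and> card (cols u b) \<le> 2) \<and>
    (\<forall>u l. tied u l \<longrightarrow> cols u (f l) = {} \<and> card (cols u (\<not> f l)) = 2) \<and>
    (\<forall>u b. mixed u \<longrightarrow> card (cols u b) = 1) \<and>
    (\<forall>u b. \<not> node u \<longrightarrow> cols u b = {}) \<and>
    (\<forall>h s u v b c. leaf h \<longrightarrow> leaf s \<longrightarrow> M h = {s} \<longrightarrow> u \<in> W h \<longrightarrow> v \<in> W s \<longrightarrow> cols u b \<inter> cols v c = {})"
proof -
  define S where "S = {x :: 'a \<times> bool. node (fst x)}"
  have "finite X" using X_V fin_V by (rule finite_subset)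
  then have "finite (X \<times> (UNIV :: bool set))" by simp
  moreover have "S \<subseteq> X \<times> UNIV" using node_X by (auto simp: S_def)
  ultimately have fS: "finite S" using finite_subset by blast
  have few: "card ({} \<union> (\<Union>y\<in>{y\<in>S. clash x y}. D y - {})) + 1 \<le> (15 :: nat)"
    if x: "x \<in> S" and D: "\<forall>y\<in>S. {} \<subseteq> D y \<and> D y \<subseteq> {..<15 :: nat} \<and> card (D y) \<le> 1" for x D
  proof -
    obtain u k where u: "x = (u, k)" by (cases x)
    have uX: "u \<in> X" using x u node_X by (auto simp: S_def)
    have fin: "finite {y\<in>S. clash x y}" using fS by simp
    have "card (\<Union>y\<in>{y\<in>S. clash x y}. D y - {}) \<le> (\<Sum>y\<in>{y\<in>S. clash x y}. card (D y - {}))"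
      using fin by (rule card_UN_le)
    also have "\<dots> \<le> (\<Sum>y\<in>{y\<in>S. clash x y}. 1)" by (rule sum_mono) (use D in auto)
    also have "\<dots> \<le> card {y. clash x y}"
      using card_mono[OF card_clash(1)[OF uX, of k], of "{y\<in>S. clash x y}"] u by auto
    finally show ?thesis using card_clash(2)[OF uX, of k] u by simp
  qed
  have "\<exists>D. \<forall>x\<in>S. {} \<subseteq> D x \<and> D x \<subseteq> {..<15 :: nat} \<and> card (D x) = 1 \<and> (D x - {}) \<inter> {} = {} \<and>
    (\<forall>y\<in>S. clash x y \<longrightarrow> (D x - {}) \<inter> (D y - {}) = {})"
  proof (rule greedy_sets[where b = "\<lambda>_. {}" and F = "\<lambda>_. {}" and n = "\<lambda>_. 1" and R = clash])
    show "clash x y \<Longrightarrow> clash y x" for x y by (rule clash_sym)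
    show "\<not> clash x x" for x by (rule clash_irrefl)
  qed (use fS in simp, simp, simp, rule few)
  then obtain D where D': "\<forall>x\<in>S. D x \<subseteq> {..<15 :: nat} \<and> card (D x) = 1 \<and>
    (\<forall>y\<in>S. clash x y \<longrightarrow> D x \<inter> D y = {})" by auto
  have D: "D x \<subseteq> {..<15}" "card (D x) = 1" if "x \<in> S" for x using D' that by auto
  have Dc: "D x \<inter> D y = {}" if "x \<in> S" "y \<in> S" "clash x y" for x y using D' that by auto
  \<comment> \<open>A mixed vertex puts one slot into each palette, a tied one puts both into the
    palette opposite to \<open>l\<close>.\<close>
  define K where "K u b = {k. mixed u \<and> k = b \<or> (\<exists>l. tied u l \<and> f l \<noteq> b)}" for u b
  define cols where "cols u b = (\<Union>k\<in>K u b. D (u, k))" for u b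
  have KS: "(u, k) \<in> S" if "k \<in> K u b" for u k b using that by (auto simp: K_def S_def node_def)
  have t: "K u (f l) = {}" "K u (\<not> f l) = UNIV" if "tied u l" for u l
    using that tied_unique tied_not_mixed by (auto simp: K_def)
  have m: "K u b = {b}" if "mixed u" for u b
    using that tied_not_mixed by (auto simp: K_def)
  have z: "K u b = {}" if "\<not> node u" for u b using that by (auto simp: K_def node_def)
  have tc: "card (cols u (\<not> f l)) = 2" if "tied u l" for u l
  proof -
    have s: "(u, True) \<in> S" "(u, False) \<in> S" using KS[of _ u "\<not> f l"] t(2)[OF that] by auto
    moreover have "clash (u, True) (u, False)" by (simp add: clash_def)
    ultimately have "D (u, True) \<inter> D (u, False) = {}" using Dc by blast
    moreover have "cols u (\<not> f l) = D (u, True) \<union> D (u, False)"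
      using t(2)[OF that] by (auto simp: cols_def UNIV_bool)
    moreover have "finite (D (u, True))" "finite (D (u, False))" "card (D (u, True)) = 1" "card (D (u, False)) = 1"
      using D[OF s(1)] D[OF s(2)] by (auto intro: card_ge_0_finite)
    ultimately show ?thesis by (simp add: card_Un_disjoint)
  qed
  have mc: "card (cols u b) = 1" if "mixed u" for u b
  proof -
    have "(u, b) \<in> S" using KS[of b u b] m[OF that] by auto
    then show ?thesis using D(2) m[OF that] by (simp add: cols_def)
  qed
  show ?thesis
  proof (intro exI[of _ cols] conjI allI impI)
    fix u b
    show "cols u b \<subseteq> {..<15}" unfolding cols_def using D(1)[OF KS] by blast
    show "card (cols u b) \<le> 2"
    proof (cases "node u")
      case False then show ?thesis using z by (simp add: cols_def)
    next
      case True
      then consider "mixed u" | l where "tied u l" by (auto simp: node_def)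
      then show ?thesis
      proof cases
        case 1 then show ?thesis using mc by simp
      next
        case 2
        then show ?thesis using tc[OF 2] t[OF 2] by (cases "b = f l") (auto simp: cols_def)
      qed
    qed
  next
    fix u l assume "tied u l"
    then show "cols u (f l) = {}" "card (cols u (\<not> f l)) = 2" using t tc by (auto simp: cols_def)
  next
    fix u b assume "mixed u" then show "card (cols u b) = 1" using mc by simp
  next
    fix u b assume "\<not> node u" then show "cols u b = {}" using z by (simp add: cols_def)
  next
    fix h s u v b c assume h: "leaf h" "leaf s" "M h = {s}" "u \<in> W h" "v \<in> W s"
    then have cl: "clash (u, k) (v, k')" for k k' by (auto simp: clash_def)
    have "D (u, k) \<inter> D (v, k') = {}" if "k \<in> K u b" "k' \<in> K v c" for k k'
      using Dc[OF KS[OF that(1)] KS[OF that(2)] cl] .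
    then show "cols u b \<inter> cols v c = {}" unfolding cols_def by blast
  qed
qed

end

section \<open>Colours given up by leaves\<close>

lemma card_le_1I:
  assumes "\<And>x y. x \<in> A \<Longrightarrow> y \<in> A \<Longrightarrow> x = y"
  shows "finite A" "card A \<le> 1"
proof -
  have "A = {} \<or> (\<exists>x. A = {x})" using assms by blast
  then show "finite A" "card A \<le> 1" by auto
qed

lemma card_UN_le_mult:
  assumes "finite I" "card I \<le> m" "\<And>i. i \<in> I \<Longrightarrow> card (A i) \<le> n"
  shows "card (\<Union>i\<in>I. A i) \<le> m * n"
proof -
  have "card (\<Union>i\<in>I. A i) \<le> (\<Sum>i\<in>I. card (A i))" using assms(1) by (rule card_UN_le)
  also have "\<dots> \<le> (\<Sum>i\<in>I. n)" by (rule sum_mono) (use assms in auto)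
  also have "\<dots> \<le> m * n" using assms(2) by simp
  finally show ?thesis .
qed

context optimal_split
begin

text \<open>
  In this situation \<open>a\<close> already has to give up two colours because of \<open>w\<close>, so that only one of its
  three colours is left for \<open>u\<close>; such an \<open>l\<close> gives up only two colours.
\<close>

definition small :: "'a \<Rightarrow> bool" where
  "small l \<longleftrightarrow> (\<exists>u a g w m. two_sided u l a g \<and> W a = {u, w} \<and> w \<noteq> u \<and> tied w m \<and> f m \<noteq> f a)"

lemma leaves_iff: "l \<notin> X \<Longrightarrow> h \<in> leaves l \<longleftrightarrow> leaf h \<and> M h = {l}"
  using leaf_M M_sym by (auto simp: leaves_def dest: leaf_X)

lemma leaves_M: "h \<in> leaves l \<Longrightarrow> h \<in> M l" "h \<in> leaves l \<Longrightarrow> leaf h" by (auto simp: leaves_def)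

lemma leaves_not_owner:
  assumes "W l = {u}" "h \<in> leaves l"
  shows "h \<notin> M u"
proof
  assume "h \<in> M u"
  moreover have "E l u" using assms(1) by (auto simp: W_iff set_eq_iff)
  ultimately show False using no_tri[of h u l] leaves_M(1)[OF assms(2)] E_sym by (auto simp: M_iff)
qed

text \<open>By \<open>strong_other\<close> the only leaf \<open>h\<close> at \<open>l\<close> is the
  third neighbour of \<open>w\<close>. It lies on the side of \<open>m\<close>, so \<open>w\<close>
  borrows nothing from its palette; this is why \<open>h\<close> can do with giving up two colours,
  as many as the small \<open>l\<close> hands over.\<close>

lemma smallE:
  assumes "small l"
  obtains h w m where "leaves l = {h}" "w \<in> W h" "tied w m" "f m = f h" "M l = {h, m}"
    "m \<notin> leaves l" "E l m"
proof -
  obtain u a g w m where s: "two_sided u l a g" "W a = {u, w}" "w \<noteq> u" "tied w m" "f m \<noteq> f a"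
    using assms unfolding small_def by blast
  note d = two_sidedD[OF s(1)] and t = tiedD[OF s(4)]
  have wa: "w \<in> W a" using s(2) by simp
  then have aw: "a \<in> M w" using W_M[OF leaf_X[OF d(4)]] by blast
  obtain x y where "x \<in> M w" "y \<in> M w" "leaf x" "leaf y" "x \<noteq> y" using s(4) by (auto simp: tied_def)
  then obtain z where z: "z \<in> M w" "leaf z" "z \<noteq> a" by metis
  have "m \<noteq> a" "m \<noteq> z" using t(1) inner_not_leaf d(4) z by auto
  then have Mw: "M w = {a, m, z}" using three_elem[OF fin_M M_X[OF t(4)] aw t(5) z(1)] z(3) by auto
  have zh: "z = h" if "h \<in> leaves l" for h
    using strong_other[OF d(1,3) that d(9,4,5,6,7,15) s(2,3) t(1,3) s(5) Mw z(2,3)] .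
  have L: "leaves l = {z}" using zh d(2) by (auto simp: support_def)
  have lX: "l \<notin> X" using inner_X[OF d(1)] .
  have zl: "z \<in> M l" using L by (auto simp: leaves_def)
  have elm: "E l m" using two_owners(1)[OF d(4,13) wa _ d(3) t(3) lX inner_X[OF t(1)]] s(3) by blast
  then have ml: "m \<in> M l" using inner_X[OF t(1)] by (simp add: M_iff)
  have Ml: "M l = {z, m}" using two_elem[OF fin_M _ zl ml] d(1) \<open>m \<noteq> z\<close> by (auto simp: inner_def)
  have "f z \<noteq> f l" using f_M[OF lX zl] .
  then have fm: "f m = f z" using s(5) d(6) by auto
  have wz: "w \<in> W z" using W_M[OF leaf_X[OF z(2)]] t(4) z(1) by blast
  show thesis using that[OF L wz s(4) fm Ml _ elm] L \<open>m \<noteq> z\<close> by auto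
qed

text \<open>A leaf that gives up only two colours must not be asked for three. As first leaf,
  \<open>h\<close> would share its side with both \<open>k\<close> and \<open>m\<close>, which
  \<open>two_owners\<close> puts on opposite sides; as second leaf, it starts the path
  \<open>h\<close>, \<open>l\<close>, \<open>m\<close>, \<open>k\<close> and is not rigid with
  respect to \<open>k\<close>.\<close>

lemma small_leaf_role:
  assumes "small l" "h \<in> leaves l"
  shows "\<not> two_sided v k h b" "\<not> two_sided v k b h"
proof -
  obtain h' w m where s: "leaves l = {h'}" "w \<in> W h'" "tied w m" "f m = f h'" "M l = {h', m}"
    "m \<notin> leaves l" "E l m" using smallE[OF assms(1)] .
  have hh: "h' = h" using assms s(1) by simp
  note t = tiedD[OF s(3)]
  have lh: "leaf h" using leaves_M(2)[OF assms(2)] .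
  have il: "inner l" using assms(1) two_sidedD(1) by (auto simp: small_def)
  have Mh: "M h = {l}" using leaves_iff[OF inner_X[OF il]] assms(2) by blast
  have vw: "v \<noteq> w" if "two_sided v k x y" for x y
  proof
    assume "v = w"
    then have "k = m" using single_unique[of k w m] two_sidedD(3)[OF that] t(3) by simp
    then show False using two_sidedD(2)[OF that] t(2) by simp
  qed
  show "\<not> two_sided v k h b"
  proof
    assume a: "two_sided v k h b"
    note d = two_sidedD[OF a]
    have "f k \<noteq> f m" using two_owners(2)[of h v w k m] lh d(3,13) s(2) hh vw[OF a] t(3)
        inner_X[OF d(1)] inner_X[OF t(1)] by auto
    then show False using d(6) s(4) hh by simp
  qed
  show "\<not> two_sided v k b h"
  proof
    assume a: "two_sided v k b h"
    note d = two_sidedD[OF a]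
    have km: "E k m" using two_owners(1)[of h v w k m] lh d(3,14) s(2) hh vw[OF a] t(3)
        inner_X[OF d(1)] inner_X[OF t(1)] by auto
    have "k \<noteq> l" using leaves_not_owner[OF d(3), of h] assms(2) d(9) by auto
    moreover have "k \<in> M m" "l \<in> M m" using km s(7) E_sym inner_X[OF d(1)] inner_X[OF il] by (auto simp: M_iff)
    ultimately have Mm: "M m = {l, k}" using two_elem[OF fin_M] t(1) by (auto simp: inner_def)
    obtain p q r where "M h = {p}" "q \<in> M p" "q \<noteq> h" "q \<noteq> k" "r \<in> M q" "r \<noteq> p" "r \<noteq> k"
      using d(16) by (auto simp: rigid_def)
    then show False using Mh s(5) hh Mm by auto
  qed
qed

lemma rigid_not_small_path:
  assumes "h \<in> leaves l" "l \<notin> X" "M l = {h, q}" "M q \<subseteq> {l, k} \<or> q = k"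
  shows "\<not> rigid h k"
proof
  assume "rigid h k"
  moreover have "M h = {l}" using leaves_iff[OF assms(2)] assms(1) by blast
  ultimately show False using assms(3,4) by (auto simp: rigid_def)
qed

section \<open>Interaction between the choices of different leaves\<close>

definition size :: "'a \<Rightarrow> nat" where "size l = (if small l then 2 else 3)"

text \<open>The colours which \<open>x\<close> gives up for \<open>u\<close> are also given up by
  \<open>l\<close> and thus reappear at these leaves.\<close>

definition hub :: "'a \<Rightarrow> 'a set" where
  "hub x = {h. \<exists>u l g. two_sided u l x g \<and> h \<in> leaves l}"

text \<open>A vertex \<open>v\<close> next to some \<open>h\<close> in \<open>hub x\<close> will
  borrow colours out of \<open>D y\<close>. They must differ from those which \<open>h\<close>
  receives, and these come from \<open>D x\<close>.\<close>

definition fwd :: "'a \<Rightarrow> 'a \<Rightarrow> bool" where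
  "fwd x y \<longleftrightarrow> (\<exists>h\<in>hub x. \<exists>v k. two_sided v k y h \<or> two_sided v k h y)"

lemma hub_eq: "two_sided u l x g \<Longrightarrow> hub x = leaves l"
  using two_sided_same_leaf(1) two_sided_same_owner unfolding hub_def by blast

text \<open>If \<open>x\<close> is the first leaf of \<open>v\<close>, then \<open>v\<close> owns
  \<open>l\<close>, and \<open>h\<close> would close a triangle with \<open>l\<close> and its owner.
  If \<open>x\<close> is the second leaf, then \<open>k\<close> is the other neighbour of
  \<open>l\<close>, and \<open>h\<close> is not rigid with respect to \<open>k\<close>.\<close>

lemma fwd_irrefl: "\<not> fwd x x"
proof
  assume "fwd x x"
  then obtain h u l g v k where h: "two_sided u l x g" "h \<in> leaves l"
    and vk: "two_sided v k x h \<or> two_sided v k h x" unfolding fwd_def hub_def by blast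
  note d = two_sidedD[OF h(1)]
  have lX: "l \<notin> X" using inner_X[OF d(1)] .
  from vk show False
  proof
    assume a: "two_sided v k x h"
    then have "u = v" using two_sided_same_leaf(1)[OF h(1) a] by simp
    then have "h \<in> M u" using two_sidedD(9)[OF a] by simp
    then show False using leaves_not_owner[OF d(3) h(2)] by simp
  next
    assume a: "two_sided v k h x"
    note d' = two_sidedD[OF a]
    have "u \<noteq> v" using two_sided_same_owner[OF h(1)] a d(10) by auto
    then have lk: "E l k" using two_owners(1)[of x u v l k] d(3,4,13) d'(3,14) lX inner_X[OF d'(1)] by auto
    then have "k \<in> M l" using inner_X[OF d'(1)] by (simp add: M_iff)
    moreover have "h \<noteq> k" using d'(11) by simp
    ultimately have "M l = {h, k}"
      using two_elem[OF fin_M _ leaves_M(1)[OF h(2)]] d(1) by (auto simp: inner_def)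
    then have "\<not> rigid h k" using rigid_not_small_path[OF h(2) lX] by blast
    then show False using d'(15) by simp
  qed
qed

text \<open>Each of the two possible roles of \<open>x\<close> determines its owner and thus
  \<open>h\<close>; the only neighbour of \<open>h\<close> outside \<open>X\<close> is a support,
  which determines \<open>y\<close>.\<close>

lemma card_bwd: "finite {y. fwd y x}" "card {y. fwd y x} \<le> 2"
proof -
  define A where "A = {y. \<exists>u l g h v k. two_sided u l y g \<and> h \<in> leaves l \<and> two_sided v k x h}"
  define B where "B = {y. \<exists>u l g h v k. two_sided u l y g \<and> h \<in> leaves l \<and> two_sided v k h x}"
  have eq: "y = y'" if "two_sided u l y g" "two_sided u' l' y' g'" "h \<in> leaves l" "h \<in> leaves l'"
    for y y' u l g u' l' g' h
  proof -
    have "M h = {l}" "M h = {l'}"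
      using leaves_iff that inner_X[OF two_sidedD(1)[OF that(1)]] inner_X[OF two_sidedD(1)[OF that(2)]] by auto
    then have "l = l'" by simp
    then show ?thesis using two_sided_same_leaf(3)[OF that(1,2)] two_sided_same_owner that(1,2) by blast
  qed
  have A: "y = y'" if "y \<in> A" "y' \<in> A" for y y'
  proof -
    obtain u l g h v k where y: "two_sided u l y g" "h \<in> leaves l" "two_sided v k x h"
      using \<open>y \<in> A\<close> unfolding A_def by blast
    obtain u' l' g' h' v' k' where y': "two_sided u' l' y' g'" "h' \<in> leaves l'" "two_sided v' k' x h'"
      using \<open>y' \<in> A\<close> unfolding A_def by blast
    have "h = h'" using two_sided_same_leaf(1)[OF y(3) y'(3)] two_sided_same_owner y(3) y'(3) by blast
    then show ?thesis using eq[OF y(1) y'(1) y(2)] y'(2) by simp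
  qed
  have B: "y = y'" if "y \<in> B" "y' \<in> B" for y y'
  proof -
    obtain u l g h v k where y: "two_sided u l y g" "h \<in> leaves l" "two_sided v k h x"
      using \<open>y \<in> B\<close> unfolding B_def by blast
    obtain u' l' g' h' v' k' where y': "two_sided u' l' y' g'" "h' \<in> leaves l'" "two_sided v' k' h' x"
      using \<open>y' \<in> B\<close> unfolding B_def by blast
    have "h = h'" using two_sided_same_leaf(2)[OF y(3) y'(3)] two_sided_same_owner y(3) y'(3) by blast
    then show ?thesis using eq[OF y(1) y'(1) y(2)] y'(2) by simp
  qed
  have AB: "{y. fwd y x} = A \<union> B" unfolding fwd_def hub_def A_def B_def by blast
  have cA: "finite A" "card A \<le> 1" using card_le_1I[of A] A by auto
  have cB: "finite B" "card B \<le> 1" using card_le_1I[of B] B by auto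
  show "finite {y. fwd y x}" using cA(1) cB(1) AB by simp
  show "card {y. fwd y x} \<le> 2" unfolding AB using cA(2) cB(2) card_Un_le[of A B] by linarith
qed

end

text \<open>
  The vertex \<open>u\<close> of \<open>X\<close> will borrow \<open>cols u b\<close> from palette \<open>b\<close>. A leaf \<open>h\<close> next to \<open>u\<close> must therefore
  give up \<open>cols u (f h)\<close> and must not take a colour of \<open>cols u (\<not> f h)\<close> in exchange.
\<close>

locale node_coloured = optimal_split +
  fixes cols :: "'a \<Rightarrow> bool \<Rightarrow> nat set"
  assumes cols_sub: "cols u b \<subseteq> {..<15}" and cols_card: "card (cols u b) \<le> 2"
    and cols_tied: "tied u l \<Longrightarrow> cols u (f l) = {} \<and> card (cols u (\<not> f l)) = 2"
    and cols_mixed: "mixed u \<Longrightarrow> card (cols u b) = 1"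
    and cols_other: "\<not> node u \<Longrightarrow> cols u b = {}"
    and cols_pair: "leaf h \<Longrightarrow> leaf s \<Longrightarrow> M h = {s} \<Longrightarrow> u \<in> W h \<Longrightarrow> v \<in> W s \<Longrightarrow> cols u b \<inter> cols v c = {}"
begin

definition cw :: "'a \<Rightarrow> bool \<Rightarrow> nat set" where "cw h b = (\<Union>u\<in>W h. cols u b)"

lemma cols_fin: "finite (cols u b)" using cols_sub finite_subset by blast

lemma cw_sub: "cw h b \<subseteq> {..<15}" using cols_sub by (auto simp: cw_def)

lemma cw_fin: "finite (cw h b)" using cw_sub finite_subset by blast

lemma cols_two:
  assumes "card (cols u b) = 2"
  obtains l where "tied u l" "f l \<noteq> b"
proof -
  have "node u" by (rule ccontr) (use cols_other[of u b] assms in simp)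
  moreover have "\<not> mixed u" using cols_mixed[of u b] assms by auto
  ultimately obtain l where l: "tied u l" by (auto simp: node_def)
  have "f l \<noteq> b"
  proof
    assume "f l = b"
    then show False using cols_tied[OF l] assms by simp
  qed
  then show thesis using that l by blast
qed

text \<open>Two demands of size two would come from tied vertices whose inner neighbours both lie
  opposite to palette \<open>b\<close>, against \<open>two_owners\<close>. Hence at most 2 +
  1.\<close>

lemma card_cw:
  assumes "leaf h"
  shows "card (cw h b) \<le> 3"
proof -
  obtain u where u: "u \<in> W h" using leaf_W(2)[OF assms] by blast
  from leaf_W_cases[OF assms u] show ?thesis
  proof cases
    case 1
    then show ?thesis using cols_card[of u b] by (simp add: cw_def)
  next
    case (2 v)
    have "cw h b = cols u b \<union> cols v b" using 2 by (auto simp: cw_def)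
    then have c: "card (cw h b) \<le> card (cols u b) + card (cols v b)" using card_Un_le by metis
    have "\<not> (card (cols u b) = 2 \<and> card (cols v b) = 2)"
    proof
      assume a: "card (cols u b) = 2 \<and> card (cols v b) = 2"
      obtain l where l: "tied u l" "f l \<noteq> b" using cols_two[of u b] a by blast
      obtain m where m: "tied v m" "f m \<noteq> b" using cols_two[of v b] a by blast
      have "f l \<noteq> f m" using two_owners(2)[of h u v l m] assms 2 tiedD[OF l(1)] tiedD[OF m(1)] inner_X by auto
      then show False using l m by auto
    qed
    then show ?thesis using c cols_card[of u b] cols_card[of v b] by linarith
  qed
qed

lemma two_sided_cols: "two_sided u l a g \<Longrightarrow> cols u b = {}"
  using cols_other two_sided_not(1,2) by (auto simp: node_def)

lemma card_cw_small:
  assumes "small l" "h \<in> leaves l"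
  shows "card (cw h (f h)) \<le> 2"
proof -
  obtain h' w m where s: "leaves l = {h'}" "w \<in> W h'" "tied w m" "f m = f h'"
    using smallE[OF assms(1)] by metis
  have hh: "h' = h" using assms s(1) by simp
  have z: "cols w (f h) = {}" using cols_tied[OF s(3)] s(4) hh by simp
  have wh: "w \<in> W h" using s(2) hh by simp
  from leaf_W_cases[OF leaves_M(2)[OF assms(2)] wh] show ?thesis
  proof cases
    case 1
    then show ?thesis using z by (simp add: cw_def)
  next
    case (2 v)
    then show ?thesis using z cols_card[of v "f h"] by (simp add: cw_def)
  qed
qed

text \<open>This is the room for \<open>core u\<close> inside \<open>D a\<close>: \<open>u\<close>
  has no entry in \<open>cols\<close>, and the other neighbour of \<open>a\<close> demands two
  colours only when \<open>l\<close> is small, where one colour for \<open>core u\<close> is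
  enough.\<close>

lemma card_cw_first:
  assumes "two_sided u l a g"
  shows "card (cw a (f a)) + (size l - 1) \<le> 3"
proof -
  note d = two_sidedD[OF assms]
  have z: "cols u b = {}" for b using two_sided_cols[OF assms] .
  from leaf_W_cases[OF d(4,13)] show ?thesis
  proof cases
    case 1
    then show ?thesis using z by (simp add: cw_def size_def)
  next
    case (2 w)
    have c: "cw a (f a) = cols w (f a)" using 2 z by (simp add: cw_def)
    show ?thesis
    proof (cases "card (cols w (f a)) = 2")
      case True
      then obtain m where "tied w m" "f m \<noteq> f a" using cols_two by blast
      then have "small l" using assms 2 unfolding small_def by blast
      then show ?thesis using c cols_card[of w "f a"] by (simp add: size_def)
    next
      case False
      then show ?thesis using c cols_card[of w "f a"] by (simp add: size_def)
    qed
  qed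
qed

text \<open>Matched to \<open>size\<close>: a leaf gives up as many colours as it receives from its
  neighbour.\<close>

definition dsize :: "'a \<Rightarrow> nat" where
  "dsize h = (if \<exists>l. M h = {l} \<and> small l then 2 else 3)"

lemma card_cw_dsize:
  assumes "leaf h"
  shows "card (cw h (f h)) \<le> dsize h"
proof (cases "\<exists>l. M h = {l} \<and> small l")
  case True
  then obtain l where l: "M h = {l}" "small l" by blast
  then have "h \<in> leaves l" using leaves_iff[of l h] assms M_not_X by blast
  then show ?thesis using card_cw_small[OF l(2)] l by (auto simp: dsize_def)
next
  case False
  then have "dsize h = 3" unfolding dsize_def by (rule if_not_P)
  then show ?thesis using card_cw[OF assms, of "f h"] by simp
qed

lemma dsize_role:
  assumes "two_sided u l a g" "x = a \<or> x = g"
  shows "dsize x = 3"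
proof -
  note d = two_sidedD[OF assms(1)]
  have "leaf x" using assms(2) d by auto
  have "\<not> small p" if "M x = {p}" for p
  proof
    assume s: "small p"
    have "x \<in> leaves p" using leaves_iff[of p x] \<open>leaf x\<close> that M_not_X by blast
    then show False using small_leaf_role[OF s] assms by blast
  qed
  then show ?thesis by (auto simp: dsize_def)
qed

text \<open>A partner leaf \<open>s\<close> takes all of \<open>D x\<close>, and a leaf in
  \<open>hub x\<close> takes the part used for \<open>core\<close>; neither may take what its
  neighbours in \<open>X\<close> borrow. Conflicts with sets not yet chosen are left to
  \<open>fwd\<close>.\<close>

definition avoid :: "'a \<Rightarrow> nat set" where
  "avoid x = (\<Union>s\<in>{s. M x = {s} \<and> leaf s}. cw s (\<not> f s)) \<union>
    (\<Union>h\<in>hub x. cw h (\<not> f h) \<union> (\<Union>g\<in>{g. \<exists>v k. two_sided v k h g}. cw g (f g)))"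

text \<open>The colours forced by a partner leaf (\<open>K\<close>, at most 3) exclude those forced
  by two-sided roles (\<open>Fw\<close> and \<open>B\<close>, at most 6 each), since leaves with a
  role do not lie in two-vertex components. The worst case 6 + 6 + 3 fills the palette.\<close>

lemma few_drop:
  assumes x: "leaf x" and D: "\<forall>y\<in>{h. leaf h}. cw y (f y) \<subseteq> D y \<and> D y \<subseteq> {..<15} \<and> card (D y) \<le> dsize y"
  shows "card (avoid x \<union> (\<Union>y\<in>{y\<in>{h. leaf h}. fwd x y \<or> fwd y x}. D y - cw y (f y))) + dsize x \<le> 15"
proof -
  have D1: "cw y (f y) \<subseteq> D y" "finite (D y)" "card (D y) \<le> 3" if "leaf y" for y
  proof -
    show "cw y (f y) \<subseteq> D y" using D that by blast
    show "finite (D y)" using D that finite_subset[of "D y" "{..<15}"] by blast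
    show "card (D y) \<le> 3" using D that by (force simp: dsize_def split: if_splits)
  qed
  let ?A = "avoid x \<union> (\<Union>y\<in>{y\<in>{h. leaf h}. fwd x y \<or> fwd y x}. D y - cw y (f y))"
  \<comment> \<open>All that one vertex \<open>v\<close> next to \<open>h\<close> can contribute;
    the alternatives exclude each other, so three colours suffice per \<open>v\<close>.\<close>
  define Z where "Z v h = cols v (\<not> f h) \<union> (\<Union>y\<in>{y. \<exists>k. two_sided v k y h \<or> two_sided v k h y}. D y)" for v h
  define B where "B = (\<Union>y\<in>{y. fwd y x}. D y)"
  define K where "K = (\<Union>s\<in>{s. M x = {s} \<and> leaf s}. cw s (\<not> f s))"
  define Fw where "Fw = (\<Union>h\<in>hub x. \<Union>v\<in>W h. Z v h)"
  have leafy: "leaf y" if "two_sided v k y h \<or> two_sided v k h y" for v k y h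
    using that two_sidedD(4,5) by blast
  have Wv: "v \<in> W h" if "two_sided v k y h \<or> two_sided v k h y" for v k y h
    using that two_sidedD(13,14) by blast
  have cwZ: "cw h (\<not> f h) \<subseteq> (\<Union>v\<in>W h. Z v h)" for h by (auto simp: cw_def Z_def)
  have DZ: "D y \<subseteq> (\<Union>v\<in>W h. Z v h)" if "two_sided v k y h \<or> two_sided v k h y" for v k y h
    using Wv[OF that] that by (auto simp: Z_def)
  have hF: "(\<Union>v\<in>W h. Z v h) \<subseteq> Fw" if "h \<in> hub x" for h
    unfolding Fw_def by (rule UN_upper[OF that])
  have s1: "cw h (\<not> f h) \<subseteq> Fw" if "h \<in> hub x" for h
    using cwZ hF[OF that] by (rule order_trans)
  have s2: "cw g (f g) \<subseteq> Fw" if h: "h \<in> hub x" and g: "two_sided v k h g" for h g v k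
  proof -
    have "cw g (f g) \<subseteq> D g" using D1(1)[OF two_sidedD(5)[OF g]] .
    also have "D g \<subseteq> (\<Union>v\<in>W h. Z v h)" using DZ g by blast
    also have "\<dots> \<subseteq> Fw" using hF[OF h] .
    finally show ?thesis .
  qed
  have s3: "D y \<subseteq> Fw" if y: "fwd x y" for y
  proof -
    obtain h v k where h: "h \<in> hub x" "two_sided v k y h \<or> two_sided v k h y"
      using y unfolding fwd_def by blast
    show ?thesis using DZ[OF h(2)] hF[OF h(1)] by (rule order_trans)
  qed
  have "avoid x \<subseteq> K \<union> Fw"
  proof -
    have "(\<Union>h\<in>hub x. cw h (\<not> f h) \<union> (\<Union>g\<in>{g. \<exists>v k. two_sided v k h g}. cw g (f g))) \<subseteq> Fw"
    proof (rule UN_least)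
      fix h assume h: "h \<in> hub x"
      have "(\<Union>g\<in>{g. \<exists>v k. two_sided v k h g}. cw g (f g)) \<subseteq> Fw"
      proof (rule UN_least)
        fix g assume "g \<in> {g. \<exists>v k. two_sided v k h g}"
        then obtain v k where "two_sided v k h g" by blast
        then show "cw g (f g) \<subseteq> Fw" by (rule s2[OF h])
      qed
      then show "cw h (\<not> f h) \<union> (\<Union>g\<in>{g. \<exists>v k. two_sided v k h g}. cw g (f g)) \<subseteq> Fw"
        using s1[OF h] by (simp only: Un_subset_iff)
    qed
    then show ?thesis unfolding avoid_def K_def by (intro Un_mono subset_refl)
  qed
  moreover have "(\<Union>y\<in>{y\<in>{h. leaf h}. fwd x y \<or> fwd y x}. D y - cw y (f y)) \<subseteq> Fw \<union> B"
  proof (rule UN_least)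
    fix y assume "y \<in> {y\<in>{h. leaf h}. fwd x y \<or> fwd y x}"
    then have "fwd x y \<or> fwd y x" by simp
    then show "D y - cw y (f y) \<subseteq> Fw \<union> B"
    proof
      assume "fwd x y" then show ?thesis using s3[of y] by blast
    next
      assume "fwd y x" then show ?thesis unfolding B_def by blast
    qed
  qed
  ultimately have sub: "?A \<subseteq> K \<union> Fw \<union> B" by blast
  have fwd_leaf: "leaf y \<and> leaf z \<and> (\<exists>u l b. two_sided u l z b \<or> two_sided u l b z)" if "fwd y z" for y z
    using that leafy two_sidedD(4) unfolding fwd_def hub_def by blast
  have finB: "finite B" and cB: "card B \<le> 6"
  proof -
    have "finite (D y) \<and> card (D y) \<le> 3" if "y \<in> {y. fwd y x}" for y using D1 fwd_leaf that by blast
    then show "finite B" "card B \<le> 6" using card_bwd[of x] card_UN_le_mult[of "{y. fwd y x}" 2 D 3]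
      unfolding B_def by auto
  qed
  have Z: "finite (Z v h) \<and> card (Z v h) \<le> 3" for v h
  proof (cases "\<exists>y k. two_sided v k y h \<or> two_sided v k h y")
    case True
    then obtain y k where y: "two_sided v k y h \<or> two_sided v k h y" by blast
    have "y' = y" if "two_sided v k' y' h \<or> two_sided v k' h y'" for y' k'
      using y that two_sided_same_owner two_sidedD(10) by metis
    then have "{y. \<exists>k. two_sided v k y h \<or> two_sided v k h y} = {y}" using y by blast
    moreover have "cols v b = {}" for b using y two_sided_cols by blast
    ultimately have "Z v h = D y" by (simp add: Z_def)
    then show ?thesis using D1 leafy[OF y] by simp
  next
    case False
    then have "Z v h = cols v (\<not> f h)" by (auto simp: Z_def)
    then show ?thesis using cols_fin cols_card[of v "\<not> f h"] by simp
  qed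
  have WZ: "finite (\<Union>v\<in>W h. Z v h) \<and> card (\<Union>v\<in>W h. Z v h) \<le> 6" if "leaf h" for h
    using card_UN_le_mult[OF fin_W leaf_W(1)[OF that], of "\<lambda>v. Z v h" 3] Z fin_W by auto
  have finF: "finite Fw" and cF: "card Fw \<le> 6"
  proof -
    have "finite Fw \<and> card Fw \<le> 6"
    proof (cases "\<exists>u l g. two_sided u l x g")
      case False
      then have "hub x = {}" by (auto simp: hub_def)
      then show ?thesis by (simp add: Fw_def)
    next
      case True
      then obtain u l g where u: "two_sided u l x g" by blast
      note d = two_sidedD[OF u]
      have lX: "l \<notin> X" using inner_X[OF d(1)] .
      have hb: "hub x = leaves l" using hub_eq[OF u] .
      have fl: "finite (leaves l)" using fin_M by (simp add: leaves_def)
      have fin: "finite Fw" unfolding Fw_def hb using fl WZ leaves_M(2) by auto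
      \<comment> \<open>A single leaf at \<open>l\<close> has two neighbours in \<open>X\<close>
        with three colours each. Two leaves at \<open>l\<close> form a three-vertex path with it, so
        they are not rigid, have no role, and contribute only \<open>cw\<close>, three colours
        each.\<close>
      show ?thesis
      proof (cases "card (leaves l) \<le> 1")
        case True
        have "card Fw \<le> 1 * 6" unfolding Fw_def hb
          by (rule card_UN_le_mult[OF fl True]) (use WZ leaves_M(2) in blast)
        then show ?thesis using fin by simp
      next
        case False
        have "leaves l \<subseteq> M l" "card (M l) = 2" using d(1) by (auto simp: leaves_def inner_def)
        then have c2: "card (leaves l) \<le> 2" and eq: "leaves l = M l"
          using card_mono[OF fin_M, of "leaves l" l] card_seteq[OF fin_M, of "leaves l" l] False by auto
        have "card (\<Union>v\<in>W h. Z v h) \<le> 3" if h: "h \<in> leaves l" for h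
        proof -
          obtain b c where bc: "M l = {b, c}" "b \<noteq> c"
            using \<open>card (M l) = 2\<close> unfolding card_2_iff by (elim exE conjE)
          then have "h = b \<or> h = c" using h eq by simp
          then obtain q where "M l = {h, q}" "q \<noteq> h"
            using that[of c] that[of b] bc by (elim disjE) (simp_all add: insert_commute)
          then have q: "M l = {h, q}" "q \<in> leaves l" using eq by simp_all
          have "M q = {l}" using leaves_iff[OF lX] q(2) by blast
          then have nr: "\<not> rigid h k" for k using rigid_not_small_path[OF h lX q(1), of k] by blast
          then have "\<not> (two_sided v k y h \<or> two_sided v k h y)" for v k y
            using two_sidedD(15,16) by blast
          then have "(\<Union>v\<in>W h. Z v h) = cw h (\<not> f h)" by (auto simp: Z_def cw_def)
          then show ?thesis using card_cw[OF leaves_M(2)[OF h]] by simp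
        qed
        then have "card Fw \<le> 2 * 3" unfolding Fw_def hb
          by (intro card_UN_le_mult[OF fl c2]) blast
        then show ?thesis using fin by simp
      qed
    qed
    then show "finite Fw" "card Fw \<le> 6" by auto
  qed
  have finK: "finite K" and cK: "card K \<le> 3"
  proof -
    obtain s where s: "M x = {s}" using leaf_ex[OF x] by blast
    have "K = (if leaf s then cw s (\<not> f s) else {})" using s by (auto simp: K_def)
    then show "finite K" "card K \<le> 3" using cw_fin card_cw by auto
  qed
  have d3: "dsize x \<le> 3" by (simp add: dsize_def)
  have le: "card ?A \<le> card (K \<union> Fw \<union> B)" using card_mono[OF _ sub] finK finF finB by simp
  show ?thesis
  proof (cases "K = {}")
    case True
    then have "card (K \<union> Fw \<union> B) \<le> card Fw + card B" using card_Un_le[of Fw B] by simp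
    then show ?thesis using le cF cB d3 by linarith
  next
    case False
    then obtain s where s: "M x = {s}" "leaf s" by (auto simp: K_def)
    then have no: "\<not> (two_sided u l x b \<or> two_sided u l b x)" for u l b
      using two_sided_poor[of u l _ _ x s] inner_not_leaf by blast
    then have "hub x = {}" by (auto simp: hub_def)
    moreover have "{y. fwd y x} = {}" using no fwd_leaf by blast
    ultimately have "Fw = {}" "B = {}" by (auto simp: Fw_def B_def)
    then show ?thesis using le cK d3 by simp
  qed
qed

lemma drop_sets_exist:
  "\<exists>D. (\<forall>h. leaf h \<longrightarrow> cw h (f h) \<subseteq> D h \<and> D h \<subseteq> {..<15} \<and> card (D h) = dsize h) \<and>
    (\<forall>h s. leaf h \<longrightarrow> leaf s \<longrightarrow> M h = {s} \<longrightarrow> D s \<inter> cw h (\<not> f h) = {}) \<and>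
    (\<forall>u l a g h. two_sided u l a g \<longrightarrow> h \<in> leaves l \<longrightarrow> (D a - cw a (f a)) \<inter> cw h (\<not> f h) = {}) \<and>
    (\<forall>u l a g h v k y. two_sided u l a g \<longrightarrow> h \<in> leaves l \<longrightarrow> two_sided v k y h \<longrightarrow>
       (D a - cw a (f a)) \<inter> (D y - cw y (f y)) = {}) \<and>
    (\<forall>u l a g h v k y. two_sided u l a g \<longrightarrow> h \<in> leaves l \<longrightarrow> two_sided v k h y \<longrightarrow>
       (D a - cw a (f a)) \<inter> D y = {})"
proof -
  define S where "S = {h. leaf h}"
  have "S \<subseteq> V" using leaf_ex M_V by (fastforce simp: S_def)
  then have fS: "finite S" using fin_V finite_subset by blast
  have av: "avoid x \<subseteq> {..<15}" for x using cw_sub unfolding avoid_def by blast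
  have "\<exists>D. \<forall>x\<in>S. cw x (f x) \<subseteq> D x \<and> D x \<subseteq> {..<15} \<and> card (D x) = dsize x \<and>
     (D x - cw x (f x)) \<inter> avoid x = {} \<and>
     (\<forall>y\<in>S. fwd x y \<or> fwd y x \<longrightarrow> (D x - cw x (f x)) \<inter> (D y - cw y (f y)) = {})"
  proof (rule greedy_sets[where b = "\<lambda>x. cw x (f x)" and F = avoid and n = dsize
        and R = "\<lambda>x y. fwd x y \<or> fwd y x" and q = 15])
    show "finite S" by (rule fS)
    show "finite (avoid x)" for x using av finite_subset by blast
    show "cw x (f x) \<subseteq> {..<15} \<and> card (cw x (f x)) \<le> dsize x" if "x \<in> S" for x
      using cw_sub card_cw_dsize that by (simp add: S_def)
    show "card (avoid x \<union> (\<Union>y\<in>{y\<in>S. fwd x y \<or> fwd y x}. D y - cw y (f y))) + dsize x \<le> 15"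
      if "x \<in> S" "\<forall>y\<in>S. cw y (f y) \<subseteq> D y \<and> D y \<subseteq> {..<15} \<and> card (D y) \<le> dsize y" for x D
      using few_drop[of x D] that unfolding S_def by blast
    show "fwd x y \<or> fwd y x \<Longrightarrow> fwd y x \<or> fwd x y" for x y by blast
    show "\<not> (fwd x x \<or> fwd x x)" for x using fwd_irrefl by blast
  qed
  then obtain D where D: "\<forall>x\<in>S. cw x (f x) \<subseteq> D x \<and> D x \<subseteq> {..<15} \<and> card (D x) = dsize x \<and>
     (D x - cw x (f x)) \<inter> avoid x = {} \<and>
     (\<forall>y\<in>S. fwd x y \<or> fwd y x \<longrightarrow> (D x - cw x (f x)) \<inter> (D y - cw y (f y)) = {})" by (elim exE)
  have D1: "cw x (f x) \<subseteq> D x" "D x \<subseteq> {..<15}" "card (D x) = dsize x" "(D x - cw x (f x)) \<inter> avoid x = {}"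
    if "leaf x" for x using D that by (auto simp: S_def)
  have D2: "(D x - cw x (f x)) \<inter> (D y - cw y (f y)) = {}" if "leaf x" "leaf y" "fwd x y" for x y
    using D that by (auto simp: S_def)
  have hb: "h \<in> hub a" if "two_sided u l a g" "h \<in> leaves l" for u l a g h
    using that by (auto simp: hub_def)
  have p3: "(D a - cw a (f a)) \<inter> (D y - cw y (f y)) = {}"
    if "two_sided u l a g" "h \<in> leaves l" "two_sided v k y h \<or> two_sided v k h y" for u l a g h v k y
  proof -
    have "fwd a y" using hb[OF that(1,2)] that(3) unfolding fwd_def by blast
    moreover have "leaf a" "leaf y" using that two_sidedD(4,5) by blast+
    ultimately show ?thesis using D2 by blast
  qed
  show ?thesis
  proof (intro exI[of _ D] conjI allI impI)
    fix h assume "leaf h"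
    then show "cw h (f h) \<subseteq> D h" "D h \<subseteq> {..<15}" "card (D h) = dsize h" using D1 by auto
  next
    fix h s assume h: "leaf h" "leaf s" "M h = {s}"
    have Ms: "M s = {h}" using leaf_M[OF h(2)] M_sym[of h s] h leaf_X[OF h(1)] by auto
    \<comment> \<open>The base of \<open>D s\<close> is handled by \<open>cols_pair\<close>, its new
      part by \<open>avoid\<close>.\<close>
    have "cw s (f s) \<inter> cw h (\<not> f h) = {}"
      using cols_pair[OF h] unfolding cw_def by blast
    moreover have "cw h (\<not> f h) \<subseteq> avoid s" using h Ms unfolding avoid_def by blast
    ultimately show "D s \<inter> cw h (\<not> f h) = {}" using D1(4)[OF h(2)] by blast
  next
    fix u l a g h assume a: "two_sided u l a g" "h \<in> leaves l"
    have "cw h (\<not> f h) \<subseteq> avoid a" using hb[OF a] unfolding avoid_def by blast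
    then show "(D a - cw a (f a)) \<inter> cw h (\<not> f h) = {}" using D1(4)[OF two_sidedD(4)[OF a(1)]] by blast
  next
    fix u l a g h v k y assume a: "two_sided u l a g" "h \<in> leaves l" "two_sided v k y h"
    show "(D a - cw a (f a)) \<inter> (D y - cw y (f y)) = {}" using p3 a by blast
  next
    fix u l a g h v k y assume a: "two_sided u l a g" "h \<in> leaves l" "two_sided v k h y"
    have "(D a - cw a (f a)) \<inter> (D y - cw y (f y)) = {}" using p3 a by blast
    moreover have "cw y (f y) \<subseteq> avoid a" using hb[OF a(1,2)] a(3) unfolding avoid_def by blast
    ultimately show "(D a - cw a (f a)) \<inter> D y = {}" using D1(4)[OF two_sidedD(4)[OF a(1)]] by blast
  qed
qed

end

section \<open>Colours given up by supports\<close>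

text \<open>
  \<open>D h\<close> consists of the colours of palette \<open>f h\<close> which the leaf \<open>h\<close> gives up.
\<close>

locale drop_coloured = node_coloured +
  fixes D :: "'a \<Rightarrow> nat set"
  assumes D_base: "leaf h \<Longrightarrow> cw h (f h) \<subseteq> D h" and D_sub: "leaf h \<Longrightarrow> D h \<subseteq> {..<15}"
    and D_card: "leaf h \<Longrightarrow> card (D h) = dsize h"
    and D_pair: "leaf h \<Longrightarrow> leaf s \<Longrightarrow> M h = {s} \<Longrightarrow> D s \<inter> cw h (\<not> f h) = {}"
    and D_first: "two_sided u l a g \<Longrightarrow> h \<in> leaves l \<Longrightarrow> (D a - cw a (f a)) \<inter> cw h (\<not> f h) = {}"
    and D_pads: "two_sided u l a g \<Longrightarrow> h \<in> leaves l \<Longrightarrow> two_sided v k y h \<Longrightarrow>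
      (D a - cw a (f a)) \<inter> (D y - cw y (f y)) = {}"
    and D_second: "two_sided u l a g \<Longrightarrow> h \<in> leaves l \<Longrightarrow> two_sided v k h y \<Longrightarrow>
      (D a - cw a (f a)) \<inter> D y = {}"
begin

lemma D_fin: "leaf h \<Longrightarrow> finite (D h)" using D_sub finite_subset by blast

lemma D_card_le: "leaf h \<Longrightarrow> card (D h) \<le> 3" "leaf h \<Longrightarrow> 2 \<le> card (D h)"
  using D_card by (auto simp: dsize_def)

text \<open>
  Where the support \<open>l\<close> of \<open>u\<close> is two-sided, \<open>u\<close> borrows \<open>core u\<close> from the palette of \<open>l\<close>, hence both \<open>l\<close> and
  the leaf \<open>a\<close> on the side of \<open>l\<close> must give up these colours.
\<close>

definition core :: "'a \<Rightarrow> nat set" where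
  "core u = (SOME S. \<exists>l a g. two_sided u l a g \<and> S \<subseteq> D a - cw a (f a) \<and> card S = size l - 1)"

lemma core:
  assumes t: "two_sided u l a g"
  shows "core u \<subseteq> D a - cw a (f a)" "card (core u) = size l - 1"
proof -
  note d = two_sidedD[OF t]
  have "card (D a - cw a (f a)) = card (D a) - card (cw a (f a))"
    using D_base[OF d(4)] cw_fin by (rule card_Diff_subset[rotated])
  then have "size l - 1 \<le> card (D a - cw a (f a))"
    using card_cw_first[OF t] D_card[OF d(4)] dsize_role[OF t, of a] by simp
  then obtain S where S: "S \<subseteq> D a - cw a (f a)" "card S = size l - 1"
    by (rule obtain_subset_with_card_n)
  let ?P = "\<lambda>S. \<exists>l a g. two_sided u l a g \<and> S \<subseteq> D a - cw a (f a) \<and> card S = size l - 1"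
  have "?P S" using S t by blast
  then have "?P (core u)" unfolding core_def by (rule someI[of ?P])
  then obtain l' a' g' where c: "two_sided u l' a' g'" "core u \<subseteq> D a' - cw a' (f a')" "card (core u) = size l' - 1"
    by (elim exE conjE)
  then show "core u \<subseteq> D a - cw a (f a)" "card (core u) = size l - 1"
    using two_sided_same_owner[OF t c(1)] by auto
qed

lemma core_fin:
  assumes "two_sided u l a g"
  shows "core u \<subseteq> {..<15}" "finite (core u)" "card (core u) \<le> 2"
proof -
  show s: "core u \<subseteq> {..<15}" using core(1)[OF assms] D_sub[OF two_sidedD(4)[OF assms]] by blast
  then show "finite (core u)" using finite_subset by blast
  show "card (core u) \<le> 2" using core(2)[OF assms] by (simp add: size_def)
qed

section \<open>Conflicts between supports\<close>

definition seed :: "'a \<Rightarrow> nat set" where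
  "seed l = (\<Union>u\<in>{u. \<exists>a g. two_sided u l a g}. core u)"

lemma seed_eq: "two_sided u l a g \<Longrightarrow> seed l = core u"
  using two_sided_same_leaf(3) unfolding seed_def by blast

lemma seed_empty: "(\<And>u a g. \<not> two_sided u l a g) \<Longrightarrow> seed l = {}"
  unfolding seed_def by blast

text \<open>The leaf \<open>y\<close> takes \<open>\<Delta> l\<close>, while its neighbour
  \<open>v\<close> borrows all of \<open>\<Delta> m\<close> from the same palette.\<close>

definition serves :: "'a \<Rightarrow> 'a \<Rightarrow> bool" where
  "serves l m \<longleftrightarrow> (\<exists>v y. one_sided v m y \<and> M y = {l} \<and> inner l)"

text \<open>The first part protects the leaves at \<open>l\<close>, which take all of
  \<open>\<Delta> l\<close>, from what their neighbours in \<open>X\<close> borrow. The second part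
  is for a one-sided \<open>l\<close>: its owner borrows all of \<open>\<Delta> l\<close>, which
  must not meet what the leaf \<open>y\<close> takes from its neighbour \<open>s\<close>.\<close>

definition avoid' :: "'a \<Rightarrow> nat set" where
  "avoid' l = (\<Union>h\<in>leaves l. cw h (\<not> f h) \<union> (\<Union>v\<in>{v. \<exists>k a. two_sided v k a h}. core v) \<union>
      (\<Union>g\<in>{g. \<exists>v k. two_sided v k h g}. D g)) \<union>
    (\<Union>y\<in>{y. \<exists>u. one_sided u l y}. \<Union>s\<in>{s. M y = {s}}. if leaf s then D s else seed s)"

lemma one_sidedD:
  assumes "one_sided u l y"
  shows "support l" "inner l" "W l = {u}" "u \<in> X" "l \<in> M u" "y \<in> M u" "leaf y" "f y \<noteq> f l" "u \<in> W y"
    "\<And>h. h \<in> M u \<Longrightarrow> leaf h \<Longrightarrow> h = y"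
proof -
  show b: "support l" "W l = {u}" "y \<in> M u" "leaf y" "f y \<noteq> f l" "\<And>h. h \<in> M u \<Longrightarrow> leaf h \<Longrightarrow> h = y"
    using assms by (auto simp: one_sided_def)
  show i: "inner l" using b(1) by (simp add: support_def)
  show u: "u \<in> X" "l \<in> M u" using owner_M[OF b(2) inner_X[OF i]] by auto
  show "u \<in> W y" using W_M[OF leaf_X[OF b(4)]] u b by blast
qed

lemma one_sided_same: "one_sided u l y \<Longrightarrow> one_sided u' l y' \<Longrightarrow> y = y' \<and> u = u'"
proof -
  assume a: "one_sided u l y" "one_sided u' l y'"
  have "u = u'" using one_sidedD(3)[OF a(1)] one_sidedD(3)[OF a(2)] by simp
  then show ?thesis using one_sidedD(10)[OF a(2)] one_sidedD(6,7)[OF a(1)] by simp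
qed

lemma one_sided_light: "one_sided u l y \<Longrightarrow> one_sided u l' y' \<Longrightarrow> l = l'"
  using one_sidedD(3)[of u l y] one_sidedD(3)[of u l' y'] single_unique[of l u l'] by simp

text \<open>With two leaves at \<open>l\<close>, at most one isolated neighbour of \<open>u\<close>
  stands against them, and \<open>support_dichotomy\<close> would give \<open>u\<close> two
  leaves.\<close>

lemma one_sided_leaves:
  assumes "one_sided u l y"
  shows "card (leaves l) \<le> 1"
proof (rule ccontr)
  assume c: "\<not> card (leaves l) \<le> 1"
  note d = one_sidedD[OF assms]
  have "{z \<in> M u. isolated z} \<subseteq> M u - {l, y}"
    using d(2,7) by (auto simp: isolated_def inner_def leaf_def)
  then have "card {z \<in> M u. isolated z} \<le> card (M u - {l, y})" using fin_M by (intro card_mono) auto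
  also have "card (M u - {l, y}) = card (M u) - 2"
    using d(5,6) inner_not_leaf[OF d(2)] d(7) by (subst card_Diff_subset) (auto simp: card_insert_if)
  finally have "card {z \<in> M u. isolated z} < card (leaves l)" using c M_X[OF d(4)] by linarith
  then obtain a g where "M u = {l, a, g}" "leaf a" "leaf g" "a \<noteq> g"
    using support_dichotomy[OF d(2,3)] by metis
  then show False using d(10)[of a] d(10)[of g] by auto
qed

lemma card_leaves: "inner l \<Longrightarrow> card (leaves l) \<le> 2" "finite (leaves l)"
proof -
  show "finite (leaves l)" using fin_M by (simp add: leaves_def)
  have "card (leaves l) \<le> card (M l)" using fin_M by (intro card_mono) (auto simp: leaves_def)
  then show "inner l \<Longrightarrow> card (leaves l) \<le> 2" by (simp add: inner_def)
qed

text \<open>Each leaf at \<open>l\<close> forbids at most 2 * 3 colours, so two leaves leave exactly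
  three. If \<open>l\<close> is one-sided, there is only one leaf, which makes room for three more
  colours coming from the neighbour of \<open>y\<close>.\<close>

lemma few_delta:
  assumes l: "support l"
    and T: "\<forall>m\<in>{m. support m}. seed m \<subseteq> T m \<and> T m \<subseteq> {..<15} \<and> card (T m) \<le> size m"
  shows "card (avoid' l \<union> (\<Union>m\<in>{m\<in>{m. support m}. serves l m \<or> serves m l}. T m - seed m)) + size l \<le> 15"
proof -
  let ?A = "avoid' l \<union> (\<Union>m\<in>{m\<in>{m. support m}. serves l m \<or> serves m l}. T m - seed m)"
  have il: "inner l" using l by (simp add: support_def)
  have T1: "seed m \<subseteq> T m" "finite (T m)" "card (T m) \<le> 3" if "support m" for m
  proof -
    show "seed m \<subseteq> T m" using T that by blast
    show "finite (T m)" using T that finite_subset[of "T m" "{..<15}"] by blast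
    have "card (T m) \<le> size m" using T that by blast
    then show "card (T m) \<le> 3" by (simp add: size_def split: if_splits)
  qed
  define Z where "Z v h = cols v (\<not> f h) \<union> (\<Union>w\<in>{w. w = v \<and> (\<exists>k a. two_sided v k a h)}. core w) \<union>
      (\<Union>g\<in>{g. \<exists>k. two_sided v k h g}. D g) \<union> (\<Union>m\<in>{m. one_sided v m h}. T m)" for v h
  define Q where "Q = (\<Union>y\<in>{y. \<exists>u. one_sided u l y}. \<Union>s\<in>{s. M y = {s}}. if leaf s then D s else T s)"
  define H where "H = (\<Union>h\<in>leaves l. \<Union>v\<in>W h. Z v h)"
  have Z: "finite (Z v h) \<and> card (Z v h) \<le> 3" for v h
  proof -
    consider (a) k a where "two_sided v k a h" | (b) k g where "two_sided v k h g"
      | (c) m where "one_sided v m h"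
      | (d) "\<forall>k a m. \<not> two_sided v k a h \<and> \<not> two_sided v k h a \<and> \<not> one_sided v m h" by blast
    then show ?thesis
    proof cases
      case a
      have "\<not> two_sided v k' h g" for k' g
        using two_sided_same_owner[OF a] two_sidedD(10)[OF a] by blast
      then have "Z v h = core v" using two_sided_cols[OF a] two_sided_not(3)[OF a] a
        unfolding Z_def by auto
      then show ?thesis using core_fin[OF a] by simp
    next
      case b
      have "\<not> two_sided v k' a h" for k' a
        using two_sided_same_owner[OF b] two_sidedD(10)[OF b] by blast
      moreover have "{g. \<exists>k. two_sided v k h g} = {g}" using two_sided_same_owner[OF b] b by blast
      ultimately have "Z v h = D g" using two_sided_cols[OF b] two_sided_not(3)[OF b]
        unfolding Z_def by auto
      then show ?thesis using D_fin D_card_le(1) two_sidedD(5)[OF b] by simp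
    next
      case c
      have t: "\<not> two_sided v k x y" for k x y using two_sided_not(3) c by blast
      have "\<not> node v"
      proof -
        note o = one_sidedD[OF c]
        have "\<not> tied v n" for n using tiedD(2,3)[of v n] single_unique[of m v n] o(1,3) by auto
        moreover have "\<not> mixed v" using o(2,5) by (auto simp: mixed_def)
        ultimately show ?thesis by (simp add: node_def)
      qed
      then have "cols v b = {}" for b by (rule cols_other)
      moreover have "{m. one_sided v m h} = {m}" using one_sided_light c by blast
      ultimately have "Z v h = T m" using t unfolding Z_def by simp
      then show ?thesis using T1 one_sidedD(1)[OF c] by simp
    next
      case d
      then have "Z v h = cols v (\<not> f h)" unfolding Z_def by simp
      then show ?thesis using cols_fin cols_card[of v "\<not> f h"] by simp
    qed
  qed
  have WZ: "finite (\<Union>v\<in>W h. Z v h) \<and> card (\<Union>v\<in>W h. Z v h) \<le> 6" if "leaf h" for h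
    using card_UN_le_mult[OF fin_W leaf_W(1)[OF that], of "\<lambda>v. Z v h" 3] Z fin_W by auto
  have hH: "Z v h \<subseteq> H" if "h \<in> leaves l" "v \<in> W h" for v h using that unfolding H_def by blast
  have sup_of: "support s" if "one_sided u m y" "M y = {s}" "inner s" for u m y s
  proof -
    have "y \<in> leaves s" using leaves_iff[OF inner_X[OF that(3)]] that(2) one_sidedD(7)[OF that(1)] by blast
    then show ?thesis using that(3) by (auto simp: support_def)
  qed
  have inner_s: "inner s" if "one_sided u m y" "M y = {s}" "\<not> leaf s" for u m y s
  proof -
    have "y \<in> M s" using M_sym[of y s] that(2) leaf_X[OF one_sidedD(7)[OF that(1)]] by simp
    moreover have "s \<in> V" "s \<notin> X" using that(2) M_V[of s y] M_not_X by auto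
    ultimately show ?thesis using trichotomy[of s] that(3) by (auto simp: isolated_def)
  qed
  have "avoid' l \<subseteq> H \<union> Q"
  proof -
    have "(\<Union>h\<in>leaves l. cw h (\<not> f h) \<union> (\<Union>v\<in>{v. \<exists>k a. two_sided v k a h}. core v) \<union>
      (\<Union>g\<in>{g. \<exists>v k. two_sided v k h g}. D g)) \<subseteq> H"
    proof (intro UN_least Un_least)
      fix h assume h: "h \<in> leaves l"
      show "cw h (\<not> f h) \<subseteq> H" unfolding cw_def
        by (rule UN_least) (use hH[OF h] in \<open>auto simp: Z_def\<close>)
      show "core v \<subseteq> H" if v: "v \<in> {v. \<exists>k a. two_sided v k a h}" for v
      proof -
        obtain k a where t: "two_sided v k a h" using v by blast
        have "core v \<subseteq> Z v h" using t unfolding Z_def by blast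
        then show ?thesis using hH[OF h two_sidedD(14)[OF t]] by (rule order_trans)
      qed
      show "D g \<subseteq> H" if g: "g \<in> {g. \<exists>v k. two_sided v k h g}" for g
      proof -
        obtain v k where t: "two_sided v k h g" using g by blast
        have "D g \<subseteq> Z v h" using t unfolding Z_def by blast
        then show ?thesis using hH[OF h two_sidedD(13)[OF t]] by (rule order_trans)
      qed
    qed
    moreover have "(\<Union>y\<in>{y. \<exists>u. one_sided u l y}. \<Union>s\<in>{s. M y = {s}}. if leaf s then D s else seed s) \<subseteq> Q"
      unfolding Q_def
    proof (intro UN_mono subset_refl)
      fix y s assume y: "y \<in> {y. \<exists>u. one_sided u l y}" "s \<in> {s. M y = {s}}"
      then obtain u where o: "one_sided u l y" "M y = {s}" by blast
      show "(if leaf s then D s else seed s) \<subseteq> (if leaf s then D s else T s)"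
        using T1(1)[OF sup_of[OF o inner_s[OF o]]] by simp
    qed
    ultimately show ?thesis unfolding avoid'_def by (rule Un_mono)
  qed
  moreover have "(\<Union>m\<in>{m\<in>{m. support m}. serves l m \<or> serves m l}. T m - seed m) \<subseteq> H \<union> Q"
  proof (rule UN_least)
    fix m assume "m \<in> {m\<in>{m. support m}. serves l m \<or> serves m l}"
    then have "serves l m \<or> serves m l" by simp
    then show "T m - seed m \<subseteq> H \<union> Q"
    proof
      assume "serves l m"
      then obtain v y where o: "one_sided v m y" "M y = {l}" unfolding serves_def by blast
      have y: "y \<in> leaves l" using leaves_iff[OF inner_X[OF il]] o(2) one_sidedD(7)[OF o(1)] by blast
      have "T m \<subseteq> Z v y" unfolding Z_def by (rule le_supI2, rule UN_upper) (use o(1) in simp)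
      also have "\<dots> \<subseteq> H" using hH[OF y one_sidedD(9)[OF o(1)]] .
      finally show ?thesis by blast
    next
      assume "serves m l"
      then obtain v y where o: "one_sided v l y" "M y = {m}" "inner m" unfolding serves_def by blast
      have "T m = (if leaf m then D m else T m)" using inner_not_leaf[OF o(3)] by simp
      also have "\<dots> \<subseteq> (\<Union>s\<in>{s. M y = {s}}. if leaf s then D s else T s)"
        by (rule UN_upper) (use o(2) in simp)
      also have "\<dots> \<subseteq> Q" unfolding Q_def by (rule UN_upper) (use o(1) in blast)
      finally show ?thesis by blast
    qed
  qed
  ultimately have sub: "?A \<subseteq> H \<union> Q" by blast
  have finH: "finite H" unfolding H_def using card_leaves(2) WZ leaves_M(2) by auto
  have H: "card H \<le> n * 6" if "card (leaves l) \<le> n" for n unfolding H_def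
    by (rule card_UN_le_mult[OF card_leaves(2) that]) (use WZ leaves_M(2) in blast)
  have sl: "size l \<le> 3" by (simp add: size_def)
  show ?thesis
  proof (cases "\<exists>u y. one_sided u l y")
    case False
    then have "Q = {}" unfolding Q_def by blast
    then have "card ?A \<le> card H" using card_mono[OF finH] sub by simp
    then show ?thesis using H[OF card_leaves(1)[OF il]] sl by simp
  next
    case True
    then obtain u y where o: "one_sided u l y" by blast
    obtain s where s: "M y = {s}" using leaf_ex[OF one_sidedD(7)[OF o]] by blast
    have "{y. \<exists>u. one_sided u l y} = {y}" using one_sided_same[OF o] o by blast
    moreover have "{s'. M y = {s'}} = {s}" using s by auto
    ultimately have Qe: "Q = (if leaf s then D s else T s)" unfolding Q_def by simp
    have Q: "finite Q" "card Q \<le> 3"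
      using Qe D_fin D_card_le(1) T1(2,3)[OF sup_of[OF o s inner_s[OF o s]]] by auto
    have "card ?A \<le> card (H \<union> Q)" using card_mono[OF _ sub] finH Q by simp
    also have "\<dots> \<le> card H + card Q" by (rule card_Un_le)
    finally show ?thesis using H[OF one_sided_leaves[OF o]] Q sl by simp
  qed
qed

lemma delta_exists:
  "\<exists>\<Delta>. (\<forall>l. support l \<longrightarrow> seed l \<subseteq> \<Delta> l \<and> \<Delta> l \<subseteq> {..<15} \<and> card (\<Delta> l) = size l) \<and>
    (\<forall>l h. support l \<longrightarrow> h \<in> leaves l \<longrightarrow> \<Delta> l \<inter> cw h (\<not> f h) = {}) \<and>
    (\<forall>l h v k a. support l \<longrightarrow> h \<in> leaves l \<longrightarrow> two_sided v k a h \<longrightarrow> \<Delta> l \<inter> core v = {}) \<and>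
    (\<forall>l h v k g. support l \<longrightarrow> h \<in> leaves l \<longrightarrow> two_sided v k h g \<longrightarrow> \<Delta> l \<inter> D g = {}) \<and>
    (\<forall>l v m y. support l \<longrightarrow> one_sided v m y \<longrightarrow> M y = {l} \<longrightarrow> \<Delta> l \<inter> \<Delta> m = {}) \<and>
    (\<forall>s v m y. leaf s \<longrightarrow> one_sided v m y \<longrightarrow> M y = {s} \<longrightarrow> D s \<inter> \<Delta> m = {})"
proof -
  define S where "S = {l. support l}"
  have "S \<subseteq> V"
  proof
    fix l assume "l \<in> S"
    then have "M l \<noteq> {}" by (auto simp: S_def support_def inner_def)
    then show "l \<in> V" using M_V by blast
  qed
  then have fS: "finite S" using fin_V finite_subset by blast
  have seed: "seed l \<subseteq> {..<15} \<and> card (seed l) \<le> size l \<and> finite (seed l)" for l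
  proof (cases "\<exists>u a g. two_sided u l a g")
    case True
    then obtain u a g where t: "two_sided u l a g" by blast
    then show ?thesis using core_fin[OF t] core(2)[OF t] seed_eq[OF t] by simp
  next
    case False
    then have "seed l = {}" by (intro seed_empty) blast
    then show ?thesis by simp
  qed
  have av: "finite (avoid' l)" if "l \<in> S" for l
  proof -
    have "avoid' l \<subseteq> {..<15}"
      unfolding avoid'_def
    proof (intro Un_least UN_least)
      fix h assume "h \<in> leaves l"
      show "cw h (\<not> f h) \<subseteq> {..<15}" by (rule cw_sub)
      show "core v \<subseteq> {..<15}" if "v \<in> {v. \<exists>k a. two_sided v k a h}" for v using that core_fin(1) by blast
      show "D g \<subseteq> {..<15}" if "g \<in> {g. \<exists>v k. two_sided v k h g}" for g
        using that D_sub two_sidedD(5) by blast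
    next
      fix y s
      show "(if leaf s then D s else seed s) \<subseteq> {..<15}" using D_sub seed by simp
    qed
    then show ?thesis using finite_subset by blast
  qed
  have "\<exists>\<Delta>. \<forall>x\<in>S. seed x \<subseteq> \<Delta> x \<and> \<Delta> x \<subseteq> {..<15} \<and> card (\<Delta> x) = size x \<and>
     (\<Delta> x - seed x) \<inter> avoid' x = {} \<and>
     (\<forall>y\<in>S. serves x y \<or> serves y x \<longrightarrow> (\<Delta> x - seed x) \<inter> (\<Delta> y - seed y) = {})"
  proof (rule greedy_sets[where b = seed and F = avoid' and n = size
        and R = "\<lambda>x y. serves x y \<or> serves y x" and q = 15])
    show "finite S" by (rule fS)
    show "finite (avoid' x)" if "x \<in> S" for x using av that .
    show "seed x \<subseteq> {..<15} \<and> card (seed x) \<le> size x" if "x \<in> S" for x using seed by blast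
    show "card (avoid' x \<union> (\<Union>y\<in>{y\<in>S. serves x y \<or> serves y x}. T y - seed y)) + size x \<le> 15"
      if "x \<in> S" "\<forall>y\<in>S. seed y \<subseteq> T y \<and> T y \<subseteq> {..<15} \<and> card (T y) \<le> size y" for x T
      using few_delta[of x T] that unfolding S_def by blast
    show "serves x y \<or> serves y x \<Longrightarrow> serves y x \<or> serves x y" for x y by blast
    show "\<not> (serves x x \<or> serves x x)" for x
    proof
      assume "serves x x \<or> serves x x"
      then obtain v y where o: "one_sided v x y" "M y = {x}" "inner x" unfolding serves_def by blast
      have "y \<in> leaves x" using leaves_iff[OF inner_X[OF o(3)]] o(2) one_sidedD(7)[OF o(1)] by blast
      then show False using leaves_not_owner[OF one_sidedD(3)[OF o(1)]] one_sidedD(6)[OF o(1)] by blast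
    qed
  qed
  then obtain \<Delta> where Dl: "\<forall>x\<in>S. seed x \<subseteq> \<Delta> x \<and> \<Delta> x \<subseteq> {..<15} \<and> card (\<Delta> x) = size x \<and>
     (\<Delta> x - seed x) \<inter> avoid' x = {} \<and>
     (\<forall>y\<in>S. serves x y \<or> serves y x \<longrightarrow> (\<Delta> x - seed x) \<inter> (\<Delta> y - seed y) = {})" by (elim exE)
  have D1: "seed x \<subseteq> \<Delta> x" "\<Delta> x \<subseteq> {..<15}" "card (\<Delta> x) = size x" "(\<Delta> x - seed x) \<inter> avoid' x = {}"
    if "support x" for x using Dl that by (auto simp: S_def)
  have D2: "(\<Delta> x - seed x) \<inter> (\<Delta> y - seed y) = {}" if "support x" "support y" "serves x y" for x y
    using Dl that by (auto simp: S_def)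
  have part: "\<Delta> l \<inter> A = {}" if "support l" "A \<subseteq> avoid' l" "seed l \<inter> A = {}" for l A
    using D1(4)[OF that(1)] that(2,3) by blast
  \<comment> \<open>For a one-sided support all of \<open>\<Delta> m\<close> is new, so separating
    new parts separates whole sets.\<close>
  have no_seed: "seed m = {}" if "one_sided v m y" for v m y
  proof (rule seed_empty)
    fix u a g
    show "\<not> two_sided u m a g"
    proof
      assume t: "two_sided u m a g"
      then have "u = v" using two_sidedD(3)[OF t] one_sidedD(3)[OF that] by simp
      then show False using two_sided_not(3)[OF t] that by blast
    qed
  qed
  show ?thesis
  proof (intro exI[of _ \<Delta>] conjI allI impI)
    fix l assume "support l"
    then show "seed l \<subseteq> \<Delta> l" "\<Delta> l \<subseteq> {..<15}" "card (\<Delta> l) = size l" using D1 by auto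
  next
    fix l h assume l: "support l" "h \<in> leaves l"
    show "\<Delta> l \<inter> cw h (\<not> f h) = {}"
    proof (rule part[OF l(1)])
      show "cw h (\<not> f h) \<subseteq> avoid' l" using l(2) unfolding avoid'_def by blast
      show "seed l \<inter> cw h (\<not> f h) = {}"
        using D_first[OF _ l(2)] core(1) unfolding seed_def by blast
    qed
  next
    fix l h v k a assume l: "support l" "h \<in> leaves l" "two_sided v k a h"
    show "\<Delta> l \<inter> core v = {}"
    proof (rule part[OF l(1)])
      show "core v \<subseteq> avoid' l" using l(2,3) unfolding avoid'_def by blast
      have "core u \<inter> core v = {}" if "two_sided u l a' g'" for u a' g'
        using D_pads[OF that l(2,3)] core(1)[OF that] core(1)[OF l(3)] by blast
      then show "seed l \<inter> core v = {}" unfolding seed_def by blast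
    qed
  next
    fix l h v k g assume l: "support l" "h \<in> leaves l" "two_sided v k h g"
    show "\<Delta> l \<inter> D g = {}"
    proof (rule part[OF l(1)])
      show "D g \<subseteq> avoid' l" unfolding avoid'_def
        by (rule le_supI1, rule SUP_upper2[OF l(2)], rule le_supI2, rule UN_upper) (use l(3) in blast)
      have "core u \<inter> D g = {}" if "two_sided u l a' g'" for u a' g'
        using D_second[OF that l(2,3)] core(1)[OF that] by blast
      then show "seed l \<inter> D g = {}" unfolding seed_def by blast
    qed
  next
    fix l v m y assume l: "support l" and o: "one_sided v m y" "M y = {l}"
    have il: "inner l" using l by (simp add: support_def)
    have "serves l m" using o il unfolding serves_def by blast
    then have p: "(\<Delta> l - seed l) \<inter> (\<Delta> m - seed m) = {}" using D2 l one_sidedD(1)[OF o(1)] by blast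
    have "seed l \<subseteq> avoid' m"
    proof -
      have "(if leaf l then D l else seed l) \<subseteq> avoid' m" unfolding avoid'_def
        by (rule le_supI2, rule SUP_upper2[of y], use o(1) in blast, rule UN_upper) (use o(2) in simp)
      then show ?thesis using inner_not_leaf[OF il] by simp
    qed
    then have "(\<Delta> m - seed m) \<inter> seed l = {}" using D1(4)[OF one_sidedD(1)[OF o(1)]] by blast
    then show "\<Delta> l \<inter> \<Delta> m = {}" using p no_seed[OF o(1)] by blast
  next
    fix s v m y assume s: "leaf s" and o: "one_sided v m y" "M y = {s}"
    have "(if leaf s then D s else seed s) \<subseteq> avoid' m" unfolding avoid'_def
      by (rule le_supI2, rule SUP_upper2[of y], use o(1) in blast, rule UN_upper) (use o(2) in simp)
    then have "D s \<subseteq> avoid' m" using s by simp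
    then show "D s \<inter> \<Delta> m = {}" using D1(4)[OF one_sidedD(1)[OF o(1)]] no_seed[OF o(1)] by blast
  qed
qed

end

section \<open>Assembling the palettes\<close>

text \<open>
  \<open>\<Delta> l\<close> consists of the colours of palette \<open>f l\<close> which the support \<open>l\<close> gives up, and \<open>T h\<close> of the colours of
  the opposite palette which the leaf \<open>h\<close> takes in exchange for \<open>D h\<close>.
\<close>

locale fully_coloured = drop_coloured +
  fixes \<Delta> :: "'a \<Rightarrow> nat set"
  assumes dl_seed: "support l \<Longrightarrow> seed l \<subseteq> \<Delta> l" and dl_sub: "support l \<Longrightarrow> \<Delta> l \<subseteq> {..<15}"
    and dl_card: "support l \<Longrightarrow> card (\<Delta> l) = size l"
    and dl_cw: "support l \<Longrightarrow> h \<in> leaves l \<Longrightarrow> \<Delta> l \<inter> cw h (\<not> f h) = {}"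
    and dl_core: "support l \<Longrightarrow> h \<in> leaves l \<Longrightarrow> two_sided v k a h \<Longrightarrow> \<Delta> l \<inter> core v = {}"
    and dl_D: "support l \<Longrightarrow> h \<in> leaves l \<Longrightarrow> two_sided v k h g \<Longrightarrow> \<Delta> l \<inter> D g = {}"
    and dl_one: "support l \<Longrightarrow> one_sided v m y \<Longrightarrow> M y = {l} \<Longrightarrow> \<Delta> l \<inter> \<Delta> m = {}"
    and dl_pair: "leaf s \<Longrightarrow> one_sided v m y \<Longrightarrow> M y = {s} \<Longrightarrow> D s \<inter> \<Delta> m = {}"
begin

definition T :: "'a \<Rightarrow> nat set" where
  "T h = (\<Union>s\<in>M h. if leaf s then D s else \<Delta> s)"

definition Dl :: "'a \<Rightarrow> nat set" where
  "Dl l = (if support l then \<Delta> l else {})"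

lemma leaf_support_cases:
  assumes "leaf h"
  obtains s where "M h = {s}" "leaf s" "T h = D s" "M s = {h}"
    | s where "M h = {s}" "\<not> leaf s" "support s" "h \<in> leaves s" "T h = \<Delta> s"
proof -
  obtain s where s: "M h = {s}" using leaf_ex[OF assms] by blast
  have hs: "h \<in> M s" using M_sym[of h s] s leaf_X[OF assms] by simp
  have sX: "s \<in> V" "s \<notin> X" using s M_V[of s h] M_not_X by auto
  show thesis
  proof (cases "leaf s")
    case True
    then show thesis using that(1)[OF s] leaf_M[OF True hs] s by (simp add: T_def)
  next
    case False
    then have "inner s" using trichotomy[OF sX] hs by (auto simp: isolated_def)
    moreover have "h \<in> leaves s" using hs assms by (simp add: leaves_def)
    ultimately have "support s" by (auto simp: support_def)
    then show thesis using that(2)[OF s False _ \<open>h \<in> leaves s\<close>] s False by (simp add: T_def)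
  qed
qed

lemma size_le: "size l \<le> 3" "2 \<le> size l" by (simp_all add: size_def)

lemma small_inner: "small l \<Longrightarrow> inner l" using two_sidedD(1) by (auto simp: small_def)

lemma dsize_pair: "M h = {s} \<Longrightarrow> leaf s \<Longrightarrow> dsize h = 3"
  using small_inner[of s] inner_not_leaf[of s] by (auto simp: dsize_def)

lemma T_sub: "leaf h \<Longrightarrow> T h \<subseteq> {..<15}"
  by (erule leaf_support_cases) (use D_sub dl_sub in auto)

lemma T_fin: "leaf h \<Longrightarrow> finite (T h)" using T_sub finite_subset by blast

lemma T_card:
  assumes "leaf h"
  shows "card (T h) = card (D h)"
  using assms
proof (cases rule: leaf_support_cases)
  case (1 s)
  then show ?thesis using dsize_pair[of h s] dsize_pair[of s h] assms D_card by simp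
next
  case (2 s)
  have "dsize h = size s" using 2(1) by (simp add: dsize_def size_def)
  then show ?thesis using 2 D_card[OF assms] dl_card by simp
qed

lemma T_cw:
  assumes "leaf h"
  shows "T h \<inter> cw h (\<not> f h) = {}"
  using assms
proof (cases rule: leaf_support_cases)
  case (1 s)
  then show ?thesis using D_pair[OF assms] by simp
next
  case (2 s)
  then show ?thesis using dl_cw by simp
qed

section \<open>What each vertex of \<open>X\<close> borrows\<close>

text \<open>The bound \<open>2 + size l\<close> arises because a support \<open>l\<close> takes
  \<open>size l\<close> colours of \<open>X\<close> away from \<open>u\<close>, on top of the two
  that are missing anyway.\<close>

definition good_use :: "'a \<Rightarrow> (bool \<Rightarrow> nat set) \<Rightarrow> bool" where
  "good_use u U \<longleftrightarrow> (\<forall>h\<in>M u. leaf h \<longrightarrow> U (f h) \<subseteq> D h \<and> U (\<not> f h) \<inter> T h = {}) \<and>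
     (\<forall>l\<in>M u. inner l \<longrightarrow> U (f l) \<subseteq> Dl l) \<and> (\<forall>b. U b \<subseteq> {..<15}) \<and>
     card (U True) + card (U False) \<le> 5 \<and> 2 \<le> card (U True) + card (U False) \<and>
     (\<forall>l\<in>M u. support l \<longrightarrow> 2 + size l \<le> card (U True) + card (U False))"

lemma card_two: "card ((U :: bool \<Rightarrow> nat set) True) + card (U False) = card (U b) + card (U (\<not> b))"
  by (cases b) auto

lemma good_useI:
  assumes "\<And>h. h \<in> M u \<Longrightarrow> leaf h \<Longrightarrow> U (f h) \<subseteq> D h \<and> U (\<not> f h) \<inter> T h = {}"
    and "\<And>l. l \<in> M u \<Longrightarrow> inner l \<Longrightarrow> U (f l) \<subseteq> Dl l" and "\<And>c. U c \<subseteq> {..<15}"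
    and "card (U b) + card (U (\<not> b)) = n" "n \<le> 5" "2 \<le> n"
    and "\<And>l. l \<in> M u \<Longrightarrow> support l \<Longrightarrow> 2 + size l \<le> n"
  shows "\<exists>U. good_use u U"
  using assms card_two[of U b] unfolding good_use_def by (intro exI[of _ U]) auto

lemma cols_use:
  assumes "h \<in> M u" "leaf h" "u \<in> X"
  shows "cols u (f h) \<subseteq> D h \<and> cols u (\<not> f h) \<inter> T h = {}"
proof -
  have "u \<in> W h" using W_M[OF leaf_X[OF assms(2)]] assms by blast
  then have "cols u b \<subseteq> cw h b" for b by (auto simp: cw_def)
  then show ?thesis using D_base[OF assms(2)] T_cw[OF assms(2)] by blast
qed

text \<open>Everything is borrowed from palette \<open>b\<close>, where only the sets taken by
  leaves are in the way: 3 * 3 + 2 or, if a support occupies one of the three places, 2 * 3 +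
  5.\<close>

lemma easy_use:
  assumes u: "u \<in> X" and b: "\<And>h. h \<in> M u \<Longrightarrow> leaf h \<or> inner h \<Longrightarrow> f h \<noteq> b"
  shows "\<exists>U. good_use u U"
proof -
  define L where "L = {h\<in>M u. leaf h}"
  define n :: nat where "n = (if \<exists>l\<in>M u. support l then 5 else 2)"
  have fL: "finite L" using fin_M by (simp add: L_def)
  have cA: "card (\<Union>h\<in>L. T h) \<le> k * 3" if "card L \<le> k" for k
    by (rule card_UN_le_mult[OF fL that]) (use T_card D_card_le(1) in \<open>auto simp: L_def\<close>)
  have fA: "finite (\<Union>h\<in>L. T h)" using fL T_fin by (auto simp: L_def)
  have "card (\<Union>h\<in>L. T h) + n \<le> 15"
  proof (cases "\<exists>l\<in>M u. support l")
    case True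
    then obtain l where l: "l \<in> M u" "inner l" by (auto simp: support_def)
    have "L \<subseteq> M u - {l}" using inner_not_leaf[OF l(2)] by (auto simp: L_def)
    then have "card L \<le> card (M u - {l})" using fin_M by (intro card_mono) auto
    then have "card L \<le> 2" using l(1) M_X[OF u] by (simp add: card_Diff_singleton)
    then show ?thesis using cA[of 2] True by (simp add: n_def)
  next
    case False
    have "card L \<le> card (M u)" using fin_M by (intro card_mono) (auto simp: L_def)
    then have "card L \<le> 3" using M_X[OF u] by simp
    then show ?thesis using cA[of 3] False by (simp add: n_def)
  qed
  then have "n \<le> card ({..<15} - (\<Union>h\<in>L. T h))"
    using diff_card_le_card_Diff[OF fA, of "{..<15}"] by simp
  then obtain S where S: "S \<subseteq> {..<15} - (\<Union>h\<in>L. T h)" "card S = n"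
    by (rule obtain_subset_with_card_n)
  define U where "U = (\<lambda>c. if c = b then S else {})"
  show ?thesis
  proof (rule good_useI[where U = U and b = b])
    fix h assume h: "h \<in> M u" "leaf h"
    then have "f h \<noteq> b" using b by blast
    moreover have "S \<inter> T h = {}" using S(1) h by (auto simp: L_def)
    ultimately show "U (f h) \<subseteq> D h \<and> U (\<not> f h) \<inter> T h = {}" by (auto simp: U_def)
  next
    fix l assume "l \<in> M u" "inner l"
    then have "f l \<noteq> b" using b by blast
    then show "U (f l) \<subseteq> Dl l" by (auto simp: U_def)
  next
    show "U c \<subseteq> {..<15}" for c using S(1) by (auto simp: U_def)
    show "card (U b) + card (U (\<not> b)) = n" using S(2) by (auto simp: U_def)
    show "n \<le> 5" "2 \<le> n" by (auto simp: n_def)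
    show "2 + size l \<le> n" if "l \<in> M u" "support l" for l
    proof -
      have "n = 5" using that by (auto simp: n_def)
      then show ?thesis using size_le(1)[of l] by simp
    qed
  qed
qed

lemma use_exists:
  assumes u: "u \<in> X"
  shows "\<exists>U. good_use u U"
proof (cases "\<exists>b. \<forall>h\<in>M u. leaf h \<or> inner h \<longrightarrow> f h \<noteq> b")
  case True
  then obtain b where "\<forall>h\<in>M u. leaf h \<or> inner h \<longrightarrow> f h \<noteq> b" by blast
  then show ?thesis using easy_use[OF u, of b] by blast
next
  case False
  then have both: "\<exists>h\<in>M u. (leaf h \<or> inner h) \<and> f h = b" for b by blast
  show ?thesis
  proof (cases "\<exists>l\<in>M u. inner l")
    case no: False
    have "mixed u" using both no u unfolding mixed_def by blast
    then have "card (cols u c) = 1" for c using cols_mixed by blast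
    then show ?thesis
    proof (intro good_useI[where U = "cols u" and b = True and n = 2])
      show "cols u (f h) \<subseteq> D h \<and> cols u (\<not> f h) \<inter> T h = {}" if "h \<in> M u" "leaf h" for h
        using cols_use[OF that u] .
      show "cols u (f l) \<subseteq> Dl l" if "l \<in> M u" "inner l" for l using that no by blast
      show "2 + size l \<le> 2" if "l \<in> M u" "support l" for l
        using that no by (auto simp: support_def)
    qed (use cols_sub in auto)
  next
    case True
    then obtain l where l: "l \<in> M u" "inner l" by blast
    have Wl: "W l = {u}" using inner_owner[OF l(2,1) u] .
    have uniq: "m = l" if "m \<in> M u" "inner m" for m using inner_unique[OF that(2) l(2) that(1) l(1) u] .
    obtain y where y: "y \<in> M u" "leaf y" "f y \<noteq> f l"
    proof -
      obtain h where h: "h \<in> M u" "leaf h \<or> inner h" "f h = (\<not> f l)" using both by blast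
      then have "leaf h" using uniq[of h] by auto
      then show thesis using that[of h] h by simp
    qed
    have yl: "f l = (\<not> f y)" using y(3) by simp
    have "2 \<le> card (D y)" using D_card_le(2)[OF y(2)] .
    then obtain S where S: "S \<subseteq> D y" "card S = 2" by (rule obtain_subset_with_card_n)
    have S15: "S \<subseteq> {..<15}" using S(1) D_sub[OF y(2)] by blast
    show ?thesis
    proof (cases "support l")
      case ns: False
      have nosup: "\<not> support m" if "m \<in> M u" for m
        using that ns uniq[of m] by (auto simp: support_def)
      show ?thesis
      proof (cases "\<exists>x\<in>M u. leaf x \<and> x \<noteq> y")
        case True
        then have t: "tied u l" using l ns Wl y unfolding tied_def by blast
        show ?thesis
        proof (rule good_useI[where U = "cols u" and b = "f l" and n = 2])
          show "cols u (f h) \<subseteq> D h \<and> cols u (\<not> f h) \<inter> T h = {}" if "h \<in> M u" "leaf h" for h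
            using cols_use[OF that u] .
          show "cols u (f m) \<subseteq> Dl m" if "m \<in> M u" "inner m" for m
            using uniq[OF that] cols_tied[OF t] by simp
          show "card (cols u (f l)) + card (cols u (\<not> f l)) = 2" using cols_tied[OF t] by simp
        qed (use cols_sub nosup in auto)
      next
        case only: False
        define U where "U = (\<lambda>c. if c = f y then S else {})"
        show ?thesis
        proof (rule good_useI[where U = U and b = "f y" and n = 2])
          show "U (f h) \<subseteq> D h \<and> U (\<not> f h) \<inter> T h = {}" if "h \<in> M u" "leaf h" for h
          proof -
            have "h = y" using only that by blast
            then show ?thesis using S by (simp add: U_def)
          qed
          show "U (f m) \<subseteq> Dl m" if "m \<in> M u" "inner m" for m
            using uniq[OF that] y(3) by (auto simp: U_def)
          show "card (U (f y)) + card (U (\<not> f y)) = 2" using S by (simp add: U_def)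
        qed (use nosup S15 in \<open>auto simp: U_def\<close>)
      qed
    next
      case sl: True
      have card_need: "2 + size m \<le> 2 + size l" if "m \<in> M u" "support m" for m
        using uniq[of m] that by (simp add: support_def)
      have Dll: "Dl l = \<Delta> l" using sl by (simp add: Dl_def)
      show ?thesis
      proof (cases "\<exists>a\<in>M u. leaf a \<and> f a = f l")
        case True
        then obtain a where a: "a \<in> M u" "leaf a" "f a = f l" by blast
        have t: "two_sided u l a y" using sl Wl a y by (simp add: two_sided_def)
        note d = two_sidedD[OF t]
        have Ta: "D y \<inter> T a = {}"
        proof -
          from a(2) show ?thesis
          proof (cases rule: leaf_support_cases)
            case (1 s)
            then show ?thesis using two_sided_poor[OF t, of a s] inner_not_leaf by blast
          next
            case (2 s)
            then show ?thesis using dl_D[OF 2(3,4) t] by (simp add: Int_commute)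
          qed
        qed
        have Ty: "core u \<inter> T y = {}"
        proof -
          from y(2) show ?thesis
          proof (cases rule: leaf_support_cases)
            case (1 s)
            then show ?thesis using two_sided_poor[OF t, of y s] inner_not_leaf by blast
          next
            case (2 s)
            then show ?thesis using dl_core[OF 2(3,4) t] by (simp add: Int_commute)
          qed
        qed
        \<comment> \<open>A second leaf gives up three colours, so the total is 3 +
          (\<open>size l\<close> - 1).\<close>
        define U where "U = (\<lambda>c. if c = f y then D y else core u)"
        show ?thesis
        proof (rule good_useI[where U = U and b = "f y" and n = "2 + size l"])
          show "U (f h) \<subseteq> D h \<and> U (\<not> f h) \<inter> T h = {}" if "h \<in> M u" "leaf h" for h
          proof -
            have "h = a \<or> h = y" using that d(9) inner_not_leaf[OF l(2)] by auto
            then show ?thesis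
            proof
              assume "h = a"
              then show ?thesis using Ta core(1)[OF t] a(3) yl by (auto simp: U_def)
            next
              assume "h = y"
              then show ?thesis using Ty by (simp add: U_def)
            qed
          qed
          show "U (f m) \<subseteq> Dl m" if "m \<in> M u" "inner m" for m
            using uniq[OF that] y(3) dl_seed[OF sl] seed_eq[OF t] Dll by (auto simp: U_def)
          show "U c \<subseteq> {..<15}" for c using D_sub[OF y(2)] core_fin(1)[OF t] by (simp add: U_def)
          show "card (U (f y)) + card (U (\<not> f y)) = 2 + size l"
            using D_card[OF y(2)] dsize_role[OF t, of y] core(2)[OF t] size_le(2)[of l] by (simp add: U_def)
        qed (use card_need size_le[of l] in auto)
      next
        case noa: False
        \<comment> \<open>A second leaf would leave no isolated neighbour at \<open>u\<close>, and
          \<open>support_dichotomy\<close> would supply a leaf on the side of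
          \<open>l\<close>.\<close>
        have only: "h = y" if h: "h \<in> M u" "leaf h" for h
        proof (rule ccontr)
          assume hy: "h \<noteq> y"
          have "M u = {l, y, h}"
            using three_elem[OF fin_M M_X[OF u] l(1) y(1) h(1)] inner_not_leaf[OF l(2)] y(2) h(2) hy by auto
          then have "{z \<in> M u. isolated z} = {}"
            using l y h by (auto simp: isolated_def leaf_def inner_def)
          moreover have "0 < card (leaves l)"
            using sl card_leaves(2) by (simp add: support_def card_gt_0_iff)
          ultimately have "card {z \<in> M u. isolated z} < card (leaves l)" by (simp only: card.empty)
          then obtain a g where "M u = {l, a, g}" "leaf a" "f a = f l"
            using support_dichotomy[OF l(2) Wl] by metis
          then show False using noa by auto
        qed
        have o: "one_sided u l y" unfolding one_sided_def using sl Wl y only by blast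
        have Ty: "\<Delta> l \<inter> T y = {}"
        proof -
          from y(2) show ?thesis
          proof (cases rule: leaf_support_cases)
            case (1 s)
            then show ?thesis using dl_pair[OF _ o 1(1)] by (simp add: Int_commute)
          next
            case (2 s)
            then show ?thesis using dl_one[OF _ o 2(1)] by (simp add: Int_commute)
          qed
        qed
        define U where "U = (\<lambda>c. if c = f y then S else \<Delta> l)"
        show ?thesis
        proof (rule good_useI[where U = U and b = "f y" and n = "2 + size l"])
          show "U (f h) \<subseteq> D h \<and> U (\<not> f h) \<inter> T h = {}" if "h \<in> M u" "leaf h" for h
            using only[OF that] S Ty by (simp add: U_def)
          show "U (f m) \<subseteq> Dl m" if "m \<in> M u" "inner m" for m
            using uniq[OF that] y(3) Dll by (auto simp: U_def)
          show "U c \<subseteq> {..<15}" for c using S15 dl_sub[OF sl] by (simp add: U_def)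
          show "card (U (f y)) + card (U (\<not> f y)) = 2 + size l"
            using S dl_card[OF sl] by (simp add: U_def)
        qed (use card_need size_le[of l] in auto)
      qed
    qed
  qed
qed

text \<open>Adjacent supports lie on opposite sides, so two disjoint blocks suffice; the second
  starts at 3, the largest size.\<close>

definition zone :: "'a \<Rightarrow> nat set" where
  "zone l = (if f l then {..<size l} else {3..<3 + size l})"

lemma zone: "zone l \<subseteq> {..<13}" "card (zone l) = size l" "f l \<noteq> f m \<Longrightarrow> zone l \<inter> zone m = {}"
  using size_le(1)[of l] size_le(1)[of m] by (auto simp: zone_def)

lemma palettes_exist:
  "\<exists>A B. palette_colouring A B"
proof -
  obtain U where U: "\<And>u. u \<in> X \<Longrightarrow> good_use u (U u)" using use_exists by metis
  define A where "A v = (if v \<in> X then {..<13} - (\<Union>l\<in>{l\<in>M v. support l}. zone l)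
    else if support v then zone v else {})" for v
  define B where "B v b = (if v \<in> X then U v b
    else if isolated v then {..<15} - (\<Union>u\<in>W v. U u b)
    else if leaf v then (if b = f v then {..<15} - D v else T v)
    else if b = f v then {..<15} - Dl v else {})" for v b
  have Usub: "U u b \<subseteq> {..<15}" if "u \<in> X" for u b using U[OF that] unfolding good_use_def by blast
  have Ufin: "finite (U u b)" if "u \<in> X" for u b using Usub[OF that] finite_subset by blast
  have sub: "A v \<subseteq> {..<13}" "B v b \<subseteq> {..<15}" for v b
  proof -
    show "A v \<subseteq> {..<13}" using zone(1) by (auto simp: A_def)
    show "B v b \<subseteq> {..<15}" using Usub T_sub[of v] by (auto simp: B_def)
  qed
  have card15: "15 \<le> card (A v) + card (B v True) + card (B v False)" if v: "v \<in> V" for v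
  proof (cases "v \<in> X")
    case True
    have c: "2 \<le> card (U v True) + card (U v False)"
      "\<And>l. l \<in> M v \<Longrightarrow> support l \<Longrightarrow> 2 + size l \<le> card (U v True) + card (U v False)"
      using U[OF True] unfolding good_use_def by auto
    show ?thesis
    proof (cases "\<exists>l\<in>M v. support l")
      case False
      then have "A v = {..<13}" using True by (auto simp: A_def)
      then show ?thesis using c(1) True by (simp add: B_def)
    next
      case ex: True
      then obtain l where l: "l \<in> M v" "support l" by blast
      then have "{l\<in>M v. support l} = {l}" using inner_unique[of _ l v] True by (auto simp: support_def)
      then have "A v = {..<13} - zone l" using True by (simp add: A_def)
      then have "card (A v) = 13 - size l"
        using zone[of l] finite_subset[OF zone(1)[of l]] by (simp add: card_Diff_subset)
      then show ?thesis using c(2)[OF l] size_le(1)[of l] True by (simp add: B_def)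
    qed
  next
    case False
    consider "isolated v" | "leaf v" "\<not> isolated v" | "inner v" "\<not> isolated v" "\<not> leaf v"
      using trichotomy[OF v False] inner_not_leaf by (auto simp: isolated_def inner_def)
    then show ?thesis
    proof cases
      case 1
      define g where "g b = (\<Sum>u\<in>W v. card (U u b))" for b
      have B: "15 - g b \<le> card (B v b)" for b
      proof -
        have WX: "W v \<subseteq> X" by (auto simp: W_iff)
        have "card (\<Union>u\<in>W v. U u b) \<le> g b" unfolding g_def using fin_W by (rule card_UN_le)
        moreover have "15 - card (\<Union>u\<in>W v. U u b) \<le> card ({..<15} - (\<Union>u\<in>W v. U u b))"
          using diff_card_le_card_Diff[of "\<Union>u\<in>W v. U u b" "{..<15}"] fin_W Ufin WX by auto
        ultimately show ?thesis using 1 False by (simp add: B_def)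
      qed
      have "g True + g False = (\<Sum>u\<in>W v. card (U u True) + card (U u False))"
        unfolding g_def by (simp add: sum.distrib)
      also have "\<dots> \<le> (\<Sum>u\<in>W v. 5)"
      proof (rule sum_mono)
        fix u assume "u \<in> W v"
        then have "u \<in> X" by (simp add: W_iff)
        then show "card (U u True) + card (U u False) \<le> 5" using U unfolding good_use_def by blast
      qed
      also have "\<dots> \<le> 15" using card_W_M[of v] by simp
      finally show ?thesis using B[of True] B[of False] by linarith
    next
      case 2
      have "card ({..<15} - D v) = 15 - card (D v)"
        using D_sub[OF 2(1)] D_fin[OF 2(1)] by (simp add: card_Diff_subset)
      then have "card (B v (f v)) + card (B v (\<not> f v)) = 15"
        using 2 False T_card[OF 2(1)] D_card_le(1)[OF 2(1)] by (simp add: B_def)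
      then show ?thesis using card_two[of "B v" "f v"] by simp
    next
      case 3
      have "card (A v) + card (B v (f v)) = 15"
      proof (cases "support v")
        case True
        have "card ({..<15} - \<Delta> v) = 15 - card (\<Delta> v)"
          using dl_sub[OF True] finite_subset[OF dl_sub[OF True]] by (simp add: card_Diff_subset)
        then show ?thesis using True 3 False zone(2)[of v] dl_card[OF True] size_le(1)[of v]
          by (simp add: A_def B_def Dl_def)
      next
        case ns: False
        then show ?thesis using 3 False by (simp add: A_def B_def Dl_def)
      qed
      then show ?thesis using card_two[of "B v" "f v"] by linarith
    qed
  qed
  have disjX: "A x \<inter> A y = {} \<and> (\<forall>b. B x b \<inter> B y b = {})" if e: "E x y" and x: "x \<in> X" for x y
  proof -
    have yX: "y \<notin> X" using e x X_indep by blast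
    have yM: "y \<in> M x" using e yX by (simp add: M_iff)
    have xW: "x \<in> W y" using e x E_sym by (simp add: W_iff)
    have yV: "y \<in> V" using E_V2[OF e] .
    have g: "leaf y \<Longrightarrow> U x (f y) \<subseteq> D y \<and> U x (\<not> f y) \<inter> T y = {}" "inner y \<Longrightarrow> U x (f y) \<subseteq> Dl y"
      using U[OF x] yM unfolding good_use_def by blast+
    have "A x \<inter> A y = {}" using x yX yM by (auto simp: A_def)
    moreover have "B x b \<inter> B y b = {}" for b
    proof -
      consider "isolated y" | "leaf y" "\<not> isolated y" | "inner y" "\<not> isolated y" "\<not> leaf y"
        using trichotomy[OF yV yX] inner_not_leaf by (auto simp: isolated_def inner_def)
      then show ?thesis
      proof cases
        case 1
        then show ?thesis using x yX xW by (auto simp: B_def)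
      next
        case 2
        then show ?thesis using x yX g(1) by (cases "b = f y") (auto simp: B_def)
      next
        case 3
        then show ?thesis using x yX g(2) by (auto simp: B_def)
      qed
    qed
    ultimately show ?thesis by blast
  qed
  have disjH: "A x \<inter> A y = {} \<and> (\<forall>b. B x b \<inter> B y b = {})"
    if e: "E x y" and x: "x \<notin> X" "y \<notin> X" and le: "leaf x \<or> inner y" for x y
  proof -
    have xy: "y \<in> M x" "x \<in> M y" using e x E_sym by (auto simp: M_iff)
    have V: "x \<in> V" "y \<in> V" using E_V[OF e] E_V2[OF e] .
    have ni: "\<not> isolated x" "\<not> isolated y" using xy by (auto simp: isolated_def)
    have fxy: "f x \<noteq> f y" using f[OF e x] .
    show ?thesis
    proof (cases "leaf x")
      case lx: True
      have Mx: "M x = {y}" using leaf_M[OF lx xy(1)] .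
      have Ax: "A x = {}" using lx x inner_not_leaf by (auto simp: A_def support_def)
      show ?thesis
      proof (cases "leaf y")
        case ly: True
        have "M y = {x}" using leaf_M[OF ly xy(2)] .
        then have "T x = D y" "T y = D x" using Mx lx ly by (simp_all add: T_def)
        then have "B x b \<inter> B y b = {}" for b using x lx ly ni fxy by (auto simp: B_def)
        then show ?thesis using Ax by simp
      next
        case ly: False
        then have "inner y" using trichotomy[OF V(2) x(2)] ni by blast
        moreover have "x \<in> leaves y" using xy lx by (simp add: leaves_def)
        ultimately have s: "support y" by (auto simp: support_def)
        have "T x = \<Delta> y" using Mx ly by (simp add: T_def)
        then have "B x b \<inter> B y b = {}" for b using x lx ly ni fxy s by (auto simp: B_def Dl_def)
        then show ?thesis using Ax by simp
      qed
    next
      case lx: False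
      then have "inner y" "\<not> leaf y" using le inner_not_leaf by auto
      \<comment> \<open>Two inner vertices use only the palettes of their own sides, so at most
        their zones could interfere.\<close>
      then have "B x b \<inter> B y b = {}" for b using x lx ni fxy by (auto simp: B_def)
      moreover have "A x \<inter> A y = {}" using x zone(3)[OF fxy] by (auto simp: A_def)
      ultimately show ?thesis by blast
    qed
  qed
  have "A x \<inter> A y = {} \<and> (\<forall>b. B x b \<inter> B y b = {})" if e: "E x y" for x y
  proof -
    have ey: "E y x" using E_sym[OF e] .
    consider "x \<in> X" | "y \<in> X" | "x \<notin> X" "y \<notin> X" "leaf x \<or> inner y" | "x \<notin> X" "y \<notin> X" "leaf y \<or> inner x"
    proof -
      have "x \<notin> X \<Longrightarrow> y \<notin> X \<Longrightarrow> leaf y \<or> inner y"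
        using trichotomy[of y] E_V2[OF e] ey by (auto simp: isolated_def M_iff set_eq_iff)
      then show thesis using that by blast
    qed
    then show ?thesis
    proof cases
      case 1 then show ?thesis using disjX[OF e] by blast
    next
      case 2 then show ?thesis using disjX[OF ey] by (simp add: Int_commute)
    next
      case 3 then show ?thesis using disjH[OF e] by blast
    next
      case 4 then show ?thesis using disjH[OF ey] by (simp add: Int_commute)
    qed
  qed
  then have "palette_colouring A B" using sub card15 unfolding palette_colouring_def by blast
  then show ?thesis by blast
qed

end

context subcubic_triangle_free
begin

lemma palette_colouring_exists:
  assumes "admissible X0"
  shows "\<exists>A B. palette_colouring A B"
proof -
  obtain X where X: "optimal X" using optimal_exists[OF assms] by blast
  then obtain f :: "'a \<Rightarrow> bool" where f: "\<forall>x y. E x y \<longrightarrow> x \<notin> X \<longrightarrow> y \<notin> X \<longrightarrow> f x \<noteq> f y"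
    unfolding optimal_def admissible_def by blast
  interpret optimal_split V E X f by unfold_locales (use X f in blast)+
  obtain cols :: "'a \<Rightarrow> bool \<Rightarrow> nat set" where
    "(\<forall>u b. cols u b \<subseteq> {..<15} \<and> card (cols u b) \<le> 2) \<and>
    (\<forall>u l. tied u l \<longrightarrow> cols u (f l) = {} \<and> card (cols u (\<not> f l)) = 2) \<and>
    (\<forall>u b. mixed u \<longrightarrow> card (cols u b) = 1) \<and>
    (\<forall>u b. \<not> node u \<longrightarrow> cols u b = {}) \<and>
    (\<forall>h s u v b c. leaf h \<longrightarrow> leaf s \<longrightarrow> M h = {s} \<longrightarrow> u \<in> W h \<longrightarrow> v \<in> W s \<longrightarrow> cols u b \<inter> cols v c = {})"
    using node_palette_exists by (elim exE)
  then interpret node_coloured V E X f cols by unfold_locales (elim conjE, metis)+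
  obtain D where
    "(\<forall>h. leaf h \<longrightarrow> cw h (f h) \<subseteq> D h \<and> D h \<subseteq> {..<15} \<and> card (D h) = dsize h) \<and>
    (\<forall>h s. leaf h \<longrightarrow> leaf s \<longrightarrow> M h = {s} \<longrightarrow> D s \<inter> cw h (\<not> f h) = {}) \<and>
    (\<forall>u l a g h. two_sided u l a g \<longrightarrow> h \<in> leaves l \<longrightarrow> (D a - cw a (f a)) \<inter> cw h (\<not> f h) = {}) \<and>
    (\<forall>u l a g h v k y. two_sided u l a g \<longrightarrow> h \<in> leaves l \<longrightarrow> two_sided v k y h \<longrightarrow>
       (D a - cw a (f a)) \<inter> (D y - cw y (f y)) = {}) \<and>
    (\<forall>u l a g h v k y. two_sided u l a g \<longrightarrow> h \<in> leaves l \<longrightarrow> two_sided v k h y \<longrightarrow>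
       (D a - cw a (f a)) \<inter> D y = {})"
    using drop_sets_exist by (elim exE)
  then interpret drop_coloured V E X f cols D by unfold_locales (elim conjE, metis)+
  obtain \<Delta> where
    "(\<forall>l. support l \<longrightarrow> seed l \<subseteq> \<Delta> l \<and> \<Delta> l \<subseteq> {..<15} \<and> card (\<Delta> l) = size l) \<and>
    (\<forall>l h. support l \<longrightarrow> h \<in> leaves l \<longrightarrow> \<Delta> l \<inter> cw h (\<not> f h) = {}) \<and>
    (\<forall>l h v k a. support l \<longrightarrow> h \<in> leaves l \<longrightarrow> two_sided v k a h \<longrightarrow> \<Delta> l \<inter> core v = {}) \<and>
    (\<forall>l h v k g. support l \<longrightarrow> h \<in> leaves l \<longrightarrow> two_sided v k h g \<longrightarrow> \<Delta> l \<inter> D g = {}) \<and>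
    (\<forall>l v m y. support l \<longrightarrow> one_sided v m y \<longrightarrow> M y = {l} \<longrightarrow> \<Delta> l \<inter> \<Delta> m = {}) \<and>
    (\<forall>s v m y. leaf s \<longrightarrow> one_sided v m y \<longrightarrow> M y = {s} \<longrightarrow> D s \<inter> \<Delta> m = {})"
    using delta_exists by (elim exE)
  then interpret fully_coloured V E X f cols D \<Delta> by unfold_locales (elim conjE, metis)+
  show ?thesis by (rule palettes_exist)
qed

end

section \<open>From palettes to the graph\<close>

lemma subcubic_triangle_free_digraph:
  fixes G :: "('a,'b) pre_digraph"
  assumes "graph G" "triangle_free G" "max_degree_le G 3"
  shows "subcubic_triangle_free (verts G) (\<lambda>x y. x \<rightarrow>\<^bsub>G\<^esub> y)"
proof
  interpret graph G by fact
  show "finite (verts G)" by (rule finite_verts)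
  show xV: "x \<in> verts G" if "x \<rightarrow>\<^bsub>G\<^esub> y" for x y using adj_in_verts(1)[OF that] .
  show "y \<rightarrow>\<^bsub>G\<^esub> x" if "x \<rightarrow>\<^bsub>G\<^esub> y" for x y using graph_symmetric[OF that] .
  show False if "x \<rightarrow>\<^bsub>G\<^esub> y" "y \<rightarrow>\<^bsub>G\<^esub> z" "z \<rightarrow>\<^bsub>G\<^esub> x" for x y z
    using that assms(2) unfolding triangle_free_def by blast
  show "card {y. x \<rightarrow>\<^bsub>G\<^esub> y} \<le> 3" for x
  proof (cases "x \<in> verts G")
    case True
    have "{y. x \<rightarrow>\<^bsub>G\<^esub> y} = head G ` out_arcs G x"
      by (auto simp: arcs_ends_def arc_to_ends_def image_iff)
    moreover have "card (head G ` out_arcs G x) \<le> out_degree G x"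
      unfolding out_degree_def by (rule card_image_le) (rule finite_out_arcs)
    ultimately show ?thesis using assms(3) True unfolding max_degree_le_def by fastforce
  next
    case False
    then have none: "{y. x \<rightarrow>\<^bsub>G\<^esub> y} = {}" using xV by blast
    show ?thesis unfolding none by simp
  qed
qed

lemma ab_coloring_blow_up:
  fixes S :: "'a \<Rightarrow> nat set"
  assumes S: "\<And>v. v \<in> verts G \<Longrightarrow> S v \<subseteq> {..<a} \<and> b \<le> card (S v)"
    and disj: "\<And>x y. x \<rightarrow>\<^bsub>G\<^esub> y \<Longrightarrow> S x \<inter> S y = {}"
  shows "\<exists>\<phi>. ab_coloring G (k * a) (k * b) \<phi>"
proof -
  have "\<exists>C. C \<subseteq> S v \<and> (v \<in> verts G \<longrightarrow> card C = b)" for v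
    using S[of v] obtain_subset_with_card_n[of b "S v"] by (cases "v \<in> verts G") blast+
  then obtain C where C: "\<And>v. C v \<subseteq> S v" "\<And>v. v \<in> verts G \<Longrightarrow> card (C v) = b" by metis
  \<comment> \<open>Each colour becomes a block of \<open>k\<close> consecutive ones;
    \<open>Suc\<close> because the target colours start at 1.\<close>
  define blow where "blow c r = Suc (k * c + r)" for c r
  have inj: "c = c' \<and> r = r'" if "blow c r = blow c' r'" "r < k" "r' < k" for c r c' r'
  proof -
    have e: "k * c + r = k * c' + r'" using that(1) by (simp add: blow_def)
    have "c = (k * c + r) div k" using that(2) by simp
    also have "\<dots> = c'" unfolding e using that(3) by simp
    finally show ?thesis using e by simp
  qed
  define \<phi> where "\<phi> v = (\<lambda>(c, r). blow c r) ` (C v \<times> {..<k})" for v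
  have "\<phi> v \<subseteq> {1..k * a}" if v: "v \<in> verts G" for v
  proof -
    have "blow c r \<le> k * a" if "c \<in> C v" "r < k" for c r
    proof -
      have "Suc c \<le> a" using that(1) C(1)[of v] S[OF v] by auto
      then have "k * Suc c \<le> k * a" by (rule mult_le_mono2)
      then show ?thesis using that(2) by (simp add: blow_def)
    qed
    then show ?thesis by (auto simp: \<phi>_def) (simp add: blow_def)
  qed
  moreover have "card (\<phi> v) = k * b" if "v \<in> verts G" for v
  proof -
    have "inj_on (\<lambda>(c, r). blow c r) (C v \<times> {..<k})"
    proof (rule inj_onI)
      fix p q assume "p \<in> C v \<times> {..<k}" "q \<in> C v \<times> {..<k}" "(case p of (c, r) \<Rightarrow> blow c r) = (case q of (c, r) \<Rightarrow> blow c r)"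
      then show "p = q" using inj[of "fst p" "snd p" "fst q" "snd q"]
        by (simp add: split_def prod_eq_iff mem_Times_iff)
    qed
    then show ?thesis using C(2)[OF that] by (simp add: \<phi>_def card_image card_cartesian_product)
  qed
  moreover have "\<phi> x \<inter> \<phi> y = {}" if "x \<rightarrow>\<^bsub>G\<^esub> y" for x y
  proof -
    have "C x \<inter> C y = {}" using disj[OF that] C(1) by blast
    moreover have "\<exists>c. c \<in> C x \<and> c \<in> C y" if n: "n \<in> \<phi> x" "n \<in> \<phi> y" for n
    proof -
      obtain c r c' r' where "c \<in> C x" "c' \<in> C y" "r < k" "r' < k" "blow c r = n" "blow c' r' = n"
        using n by (auto simp: \<phi>_def)
      then show ?thesis using inj[of c r c' r'] by auto
    qed
    ultimately show ?thesis by blast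
  qed
  ultimately show ?thesis unfolding ab_coloring_def by blast
qed

theorem theorem2:
  fixes G :: "('a,'b) pre_digraph"
  assumes "graph G"
    and "triangle_free G"
    and "max_degree_le G 3"
    and "\<exists>f. good_3_coloring G f"
  shows "\<exists>\<phi>. ab_coloring G 172 60 \<phi>"
proof -
  interpret subcubic_triangle_free "verts G" "\<lambda>x y. x \<rightarrow>\<^bsub>G\<^esub> y"
    using subcubic_triangle_free_digraph[OF assms(1-3)] .
  obtain f where "good_3_coloring G f" using assms(4) by blast
  then have "proper_3_coloring G f" unfolding good_3_coloring_def by (rule conjunct1)
  then have f: "\<forall>v\<in>verts G. f v \<in> {1,2,3}" "\<forall>u v. u \<rightarrow>\<^bsub>G\<^esub> v \<longrightarrow> f u \<noteq> f v"
    by (simp_all add: proper_3_coloring_def)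
  \<comment> \<open>Any colour class would do as a start; the other two classes are the sides of its
    complement.\<close>
  have "admissible {v\<in>verts G. f v = 1}"
    unfolding admissible_def
  proof (intro conjI exI[of _ "\<lambda>v. f v = 2"] allI impI)
    fix x y assume e: "x \<rightarrow>\<^bsub>G\<^esub> y" and "x \<notin> {v\<in>verts G. f v = 1}" "y \<notin> {v\<in>verts G. f v = 1}"
    then have "f x \<in> {2,3}" "f y \<in> {2,3}" using f(1) E_V[OF e] E_V2[OF e] by auto
    then show "(f x = 2) \<noteq> (f y = 2)" using f(2) e by fastforce
  qed (use f(2) in \<open>fastforce+\<close>)
  then obtain A B where AB: "palette_colouring A B" using palette_colouring_exists by blast
  \<comment> \<open>The offsets 13 and 28 = 13 + 15 put the two palettes behind the colours of
    \<open>X\<close>, for 43 in all; blocks of size four then give 172 = 4 * 43 and 60 = 4 *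
    15.\<close>
  define P where "P v = (+) 13 ` B v True" for v
  define Q where "Q v = (+) 28 ` B v False" for v
  have sub: "A v \<subseteq> {..<13}" "P v \<subseteq> {13..<28}" "Q v \<subseteq> {28..<43}" if "v \<in> verts G" for v
  proof -
    have "A v \<subseteq> {..<13}" and B: "\<And>b. B v b \<subseteq> {..<15}"
      using AB that unfolding palette_colouring_def by blast+
    then show "A v \<subseteq> {..<13}" by blast
    show "P v \<subseteq> {13..<28}" using B[of True] by (auto simp: P_def)
    show "Q v \<subseteq> {28..<43}" using B[of False] by (auto simp: Q_def)
  qed
  have apart: "{..<13 :: nat} \<inter> {13..<28} = {}" "{..<13 :: nat} \<inter> {28..<43} = {}"
    "{13..<28 :: nat} \<inter> {28..<43} = {}" by auto
  have "A v \<union> P v \<union> Q v \<subseteq> {..<43} \<and> 15 \<le> card (A v \<union> P v \<union> Q v)" if v: "v \<in> verts G" for v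
  proof -
    note sub = sub[OF v]
    have "finite (A v)" "finite (P v)" "finite (Q v)" using sub finite_subset by blast+
    moreover have "A v \<inter> P v = {}" "(A v \<union> P v) \<inter> Q v = {}" using sub apart by blast+
    ultimately have "card (A v \<union> P v \<union> Q v) = card (A v) + card (P v) + card (Q v)"
      by (simp add: card_Un_disjoint)
    also have "\<dots> = card (A v) + card (B v True) + card (B v False)"
      by (simp add: P_def Q_def card_image)
    finally have "15 \<le> card (A v \<union> P v \<union> Q v)"
      using AB v unfolding palette_colouring_def by simp
    moreover have "A v \<union> P v \<union> Q v \<subseteq> {..<43}" using sub by fastforce
    ultimately show ?thesis by blast
  qed
  moreover have "(A x \<union> P x \<union> Q x) \<inter> (A y \<union> P y \<union> Q y) = {}" if e: "x \<rightarrow>\<^bsub>G\<^esub> y" for x y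
  proof -
    have "A x \<inter> A y = {}" and B: "\<And>b. B x b \<inter> B y b = {}"
      using AB e unfolding palette_colouring_def by blast+
    moreover have "P x \<inter> P y = {}" using B[of True] by (auto simp: P_def)
    moreover have "Q x \<inter> Q y = {}" using B[of False] by (auto simp: Q_def)
    ultimately show ?thesis using sub[OF E_V[OF e]] sub[OF E_V2[OF e]] apart by blast
  qed
  ultimately show ?thesis
    using ab_coloring_blow_up[of G "\<lambda>v. A v \<union> P v \<union> Q v" 43 15 4] by simp
qed

end
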